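(* Let $\mathcal C=(D,E)$ be a countably infinite irreflexive directed graph with a fixed enumeration of $D$. For $a,a'\in\mathbb N^D$, the following conditions are equivalent. (1) There are $\pi\in\operatorname{Aut}(\mathcal C)$ and $M\in\mathbb N$ such that $|a(d)-a'(\pi d)|\le M$ for all $d\in D$. (2) $\Gamma(a)\cong\Gamma(a')$ in $\operatorname{Pro}_\omega(\mathsf{mGraphEpi})$. (3) There are $\pi\in\operatorname{Aut}(\mathcal C)$ and a uniform homeomorphism $h:[T_a]\to[T_{a'}]$ satisfying $h(z_d)=z_{\pi d}$ for all $d\in D$. (4) There are $\pi\in\operatorname{Aut}(\mathcal C)$ and a bi-Lipschitz homeomorphism $h:[T_a]\to[T_{a'}]$ satisfying $h(z_d)=z_{\pi d}$ for all $d\in D$. If $M$ witnesses (1), the homeomorphism in (4) can be chosen $2^M$-bi-Lipschitz.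
   Context: $\mathbb N=\{0,1,2,\ldots\}$, $\mathbb N_{>0}=\{1,2,\ldots\}$, $2\mathbb N=\{2k:k\in\mathbb N\}$. Fix a bijection $i\mapsto d_i$ from $\mathbb N$ onto $D$. Trees. A tree on $\mathbb N$ is a nonempty subset of $\mathbb N^{<\mathbb N}$ closed under initial segments; $x\restriction n$ is the initial segment of $x$ of length $n$. The branch space is $[T]=\{x\in\mathbb N^{\mathbb N}:x\restriction n\in T\text{ for all }n\}$, with metric $d_T(x,y)=2^{-\nu(x,y)}$, $\nu(x,y)=\min\{j:x(j)\ne y(j)\}$ for $x\neq y$, and $d_T(x,x)=0$. Weighted tree. For $d=d_i$ put $z_d=z_{d_i}=(2i,0,0,\ldots)$. For $a\in\mathbb N^D$, $d\in D$ and $r\ge2$, the block $B_a(d,r)$ is the set of $x\in\mathbb N^{\mathbb N}$ with $x\restriction r=z_d\restriction r$, $x(r)=2q+1$ for some $q\in\mathbb N$ with $q<2^{a(d)}$, and $x(r+s+1)\in\{1,3\}$ for every $s\in\mathbb N$. $T_a$ consists of $(2\mathbb N)^{<\mathbb N}$ together with all finite initial segments of branches in the blocks $B_a(d,r)$ ($d\in D$, $r\ge2$). Uniform homeomorphism: a bijection that is uniformly continuous with uniformly continuous inverse. A homeomorphism $h:(X,d_X)\to(Y,d_Y)$ is $L$-bi-Lipschitz ($L\ge1$) if $L^{-1}d_X(x,y)\le d_Y(h(x),h(y))\le L\,d_X(x,y)$ for all $x,y$; it is bi-Lipschitz if it is so for some $L$. Graphs. An $m$-graph (directed multigraph) consists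 of a vertex set, an edge set, and source and target maps from edges to vertices; an $m$-graph map is a pair of maps (on vertices and on edges) preserving source and target. $\mathsf{mGraphEpi}$ is the category of countable $m$-graphs and $m$-graph maps surjective on vertices and on edges. An ordinary directed graph (possibly with loops) is regarded as an $m$-graph with one edge for each related pair. Inverse systems. An inverse system $X$ in a category $\mathsf K$ consists of objects $X_n$ ($n\in\mathbb N_{>0}$) and bonding maps $p^X_{m,n}:X_m\to X_n$ for $m\ge n$, with $p^X_{n,n}=\mathrm{id}$ and $p^X_{m,n}\circ p^X_{l,m}=p^X_{l,n}$. A pre-morphism $(\phi,f):X\to Y$ is a strictly increasing map $\phi:\mathbb N_{>0}\to\mathbb N_{>0}$ with morphisms $f_n:X_{\phi(n)}\to Y_n$ satisfying $p^Y_{m,n}\circ f_m=f_n\circ p^X_{\phi(m),\phi(n)}$ for $m\ge n\ge1$. Pre-morphisms $(\phi,f),(\phi',f')$ are equivalent if for each $n\ge1$ there is $r\ge\phi(n),\phi'(n)$ with $f_n\circ p^X_{r,\phi(n)}=f'_n\circ p^X_{r,\phi'(n)}$. $\operatorname{Pro}_\omega(\mathsf K)$ has inverse systems as objects and equivalence classes of pre-morphisms as morphisms; the composite of $(\phi,f):X\to Y$ and $(\psi,g):Y\to Z$ has index $\phi\circ\psi$ and stage maps $g_n\circ f_{\psi(n)}$. The system $\Gamma(a)$. For $n\ge1$, $\Gamma_n(a)$ has vertex set $T_a\cap\mathbb N^n$; its edges are a loop at each distinguished vertex $z_d\restriction n$ ($d\in D$) and an edge $z_d\restriction n\to z_e\restriction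 n$ for each pair $d\ne e$ with $d\mathrel E e$, and no others. For $m\ge n$, $p^a_{m,n}:\Gamma_m(a)\to\Gamma_n(a)$ is $s\mapsto s\restriction n$ on vertices and sends each loop (labelled by $d$) and each copied edge (labelled by $(d,e)$) to the edge of $\Gamma_n(a)$ with the same label. $\Gamma(a)=(\Gamma_n(a),p^a_{m,n})_{m\ge n\ge1}$, an object of $\operatorname{Pro}_\omega(\mathsf{mGraphEpi})$. *)

theory Defs
  imports "HOL-Analysis.Analysis" "Graph_Theory.Digraph"
begin

section \<open>Trees on the natural numbers and their branch spaces\<close>

definition restr :: "(nat \<Rightarrow> nat) \<Rightarrow> nat \<Rightarrow> nat list" where
  "restr x n = map x [0..<n]"

definition branches :: "nat list set \<Rightarrow> (nat \<Rightarrow> nat) set" where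
  "branches T = {x. \<forall>n. restr x n \<in> T}"

definition seq_dist :: "(nat \<Rightarrow> nat) \<Rightarrow> (nat \<Rightarrow> nat) \<Rightarrow> real" where
  "seq_dist x y = (if x = y then 0 else (1/2) ^ (LEAST j. x j \<noteq> y j))"

lemma seq_dist_ultra: "seq_dist x z \<le> max (seq_dist x y) (seq_dist y z)"
proof (cases "x = y \<or> y = z \<or> x = z")
  case True
  then show ?thesis by (elim disjE) (simp_all add: seq_dist_def le_max_iff_disj)
next
  case False
  define m where "m = (LEAST j. x j \<noteq> z j)"
  define p where "p = (LEAST j. x j \<noteq> y j)"
  define q where "q = (LEAST j. y j \<noteq> z j)"
  have "\<exists>j. x j \<noteq> z j" using False by (auto simp: fun_eq_iff)
  then have "x m \<noteq> z m" unfolding m_def by (rule LeastI_ex)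
  then have "x m \<noteq> y m \<or> y m \<noteq> z m" by auto
  then have "p \<le> m \<or> q \<le> m"
    unfolding p_def q_def by (blast intro: Least_le)
  then have "(1/2::real) ^ m \<le> (1/2) ^ p \<or> (1/2::real) ^ m \<le> (1/2) ^ q"
    using power_decreasing[of _ _ "1/2::real"] by auto
  moreover have "seq_dist x z = (1/2) ^ m" "seq_dist x y = (1/2) ^ p" "seq_dist y z = (1/2) ^ q"
    using False by (simp_all add: seq_dist_def m_def p_def q_def)
  ultimately show ?thesis by (simp only: le_max_iff_disj)
qed

lemma Metric_space_seq_dist: "Metric_space A seq_dist"
proof
  show nonneg: "0 \<le> seq_dist x y" for x y by (simp add: seq_dist_def)
  show "seq_dist x y = seq_dist y x" for x y
  proof -
    have "(\<lambda>j. x j \<noteq> y j) = (\<lambda>j. y j \<noteq> x j)" by (simp only: neq_commute)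
    then show ?thesis by (simp only: seq_dist_def eq_commute[of x y])
  qed
  show "seq_dist x y = 0 \<longleftrightarrow> x = y" for x y by (simp add: seq_dist_def)
  show "seq_dist x z \<le> seq_dist x y + seq_dist y z" for x y z
    using seq_dist_ultra[of x z y] nonneg[of x y] nonneg[of y z] by linarith
qed

definition branch_space :: "nat list set \<Rightarrow> (nat \<Rightarrow> nat) metric" where
  "branch_space T = metric (branches T, seq_dist)"

lemma mspace_branch_space [simp]: "mspace (branch_space T) = branches T"
  unfolding branch_space_def by (rule Metric_space.mspace_metric[OF Metric_space_seq_dist])

lemma mdist_branch_space [simp]: "mdist (branch_space T) = seq_dist"
  unfolding branch_space_def by (rule Metric_space.mdist_metric[OF Metric_space_seq_dist])

definition uniform_homeomorphism :: "'a metric \<Rightarrow> 'b metric \<Rightarrow> ('a \<Rightarrow> 'b) \<Rightarrow> bool" where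
  "uniform_homeomorphism X Y h \<longleftrightarrow>
     bij_betw h (mspace X) (mspace Y) \<and>
     uniformly_continuous_map X Y h \<and>
     uniformly_continuous_map Y X (inv_into (mspace X) h)"

definition bi_Lipschitz_homeo_with :: "real \<Rightarrow> 'a metric \<Rightarrow> 'b metric \<Rightarrow> ('a \<Rightarrow> 'b) \<Rightarrow> bool" where
  "bi_Lipschitz_homeo_with L X Y h \<longleftrightarrow>
     L \<ge> 1 \<and> homeomorphic_map (mtopology_of X) (mtopology_of Y) h \<and>
     (\<forall>x\<in>mspace X. \<forall>y\<in>mspace X.
        inverse L * mdist X x y \<le> mdist Y (h x) (h y) \<and> mdist Y (h x) (h y) \<le> L * mdist X x y)"

definition bi_Lipschitz_homeo :: "'a metric \<Rightarrow> 'b metric \<Rightarrow> ('a \<Rightarrow> 'b) \<Rightarrow> bool" where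
  "bi_Lipschitz_homeo X Y h \<longleftrightarrow> (\<exists>L. bi_Lipschitz_homeo_with L X Y h)"


section \<open>Weighted trees\<close>

text \<open>
  Throughout, the enumeration of the vertex set \<open>D\<close> is a bijection \<open>enum\<close> from the natural numbers
  onto \<open>D\<close>, and a function on \<open>D\<close> is a total function of which only the values on \<open>D\<close> are used.
\<close>

definition zbr :: "(nat \<Rightarrow> 'd) \<Rightarrow> 'd \<Rightarrow> nat \<Rightarrow> nat" where
  "zbr enum d = (\<lambda>k. if k = 0 then 2 * inv enum d else 0)"

definition block :: "(nat \<Rightarrow> 'd) \<Rightarrow> ('d \<Rightarrow> nat) \<Rightarrow> 'd \<Rightarrow> nat \<Rightarrow> (nat \<Rightarrow> nat) set" where
  "block enum a d r =
     {x. restr x r = restr (zbr enum d) r \<and>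
         (\<exists>q. q < 2 ^ a d \<and> x r = 2 * q + 1) \<and>
         (\<forall>s. x (r + s + 1) \<in> {1, 3})}"

definition wtree :: "'d set \<Rightarrow> (nat \<Rightarrow> 'd) \<Rightarrow> ('d \<Rightarrow> nat) \<Rightarrow> nat list set" where
  "wtree D enum a =
     lists {k. even k} \<union> {restr x n | x n d r. d \<in> D \<and> r \<ge> 2 \<and> x \<in> block enum a d r}"

definition digraph_Aut :: "'d set \<Rightarrow> 'd rel \<Rightarrow> ('d \<Rightarrow> 'd) set" where
  "digraph_Aut D E =
     {\<pi>. bij_betw \<pi> D D \<and> (\<forall>d\<in>D. \<forall>e\<in>D. (d, e) \<in> E \<longleftrightarrow> (\<pi> d, \<pi> e) \<in> E)}"


section \<open>Categories and inverse systems\<close>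

text \<open>\<open>Comp K x y z g f\<close> is the composite of \<open>f \<in> Hom K x y\<close> followed by \<open>g \<in> Hom K y z\<close>.\<close>

record ('o, 'm) category =
  Obj :: "'o set"
  Hom :: "'o \<Rightarrow> 'o \<Rightarrow> 'm set"
  Ident :: "'o \<Rightarrow> 'm"
  Comp :: "'o \<Rightarrow> 'o \<Rightarrow> 'o \<Rightarrow> 'm \<Rightarrow> 'm \<Rightarrow> 'm"

definition is_category :: "('o, 'm) category \<Rightarrow> bool" where
  "is_category K \<longleftrightarrow>
     (\<forall>x\<in>Obj K. Ident K x \<in> Hom K x x) \<and>
     (\<forall>x\<in>Obj K. \<forall>y\<in>Obj K. \<forall>z\<in>Obj K. \<forall>f\<in>Hom K x y. \<forall>g\<in>Hom K y z.
        Comp K x y z g f \<in> Hom K x z) \<and>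
     (\<forall>x\<in>Obj K. \<forall>y\<in>Obj K. \<forall>f\<in>Hom K x y.
        Comp K x x y f (Ident K x) = f \<and> Comp K x y y (Ident K y) f = f) \<and>
     (\<forall>w\<in>Obj K. \<forall>x\<in>Obj K. \<forall>y\<in>Obj K. \<forall>z\<in>Obj K.
        \<forall>f\<in>Hom K w x. \<forall>g\<in>Hom K x y. \<forall>h\<in>Hom K y z.
        Comp K w x z (Comp K x y z h g) f = Comp K w y z h (Comp K w x y g f))"

definition isomorphic_in :: "('o, 'm) category \<Rightarrow> 'o \<Rightarrow> 'o \<Rightarrow> bool" where
  "isomorphic_in K x y \<longleftrightarrow>
     x \<in> Obj K \<and> y \<in> Obj K \<and>
     (\<exists>f\<in>Hom K x y. \<exists>g\<in>Hom K y x. Comp K x y x g f = Ident K x \<and> Comp K y x y f g = Ident K y)"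

text \<open>
  Indices range over the positive integers; the values of the functions below at the index \<open>0\<close> carry
  no information. Two inverse systems or pre-morphisms that differ only there are isomorphic,
  respectively equivalent.
\<close>

record ('o, 'm) inv_sys =
  stage :: "nat \<Rightarrow> 'o"
  bond :: "nat \<Rightarrow> nat \<Rightarrow> 'm"

definition inverse_systems :: "('o, 'm) category \<Rightarrow> ('o, 'm) inv_sys set" where
  "inverse_systems K =
     {X. (\<forall>n\<ge>1. stage X n \<in> Obj K) \<and>
         (\<forall>n\<ge>1. \<forall>m\<ge>n. bond X m n \<in> Hom K (stage X m) (stage X n)) \<and>
         (\<forall>n\<ge>1. bond X n n = Ident K (stage X n)) \<and>
         (\<forall>n\<ge>1. \<forall>m\<ge>n. \<forall>l\<ge>m.
            Comp K (stage X l) (stage X m) (stage X n) (bond X m n) (bond X l m) = bond X l n)}"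

type_synonym 'm premor = "(nat \<Rightarrow> nat) \<times> (nat \<Rightarrow> 'm)"

definition premorphisms ::
  "('o, 'm) category \<Rightarrow> ('o, 'm) inv_sys \<Rightarrow> ('o, 'm) inv_sys \<Rightarrow> 'm premor set" where
  "premorphisms K X Y =
     {(\<phi>, f). \<phi> \<in> {1..} \<rightarrow> {1..} \<and> strict_mono_on {1..} \<phi> \<and>
        (\<forall>n\<ge>1. f n \<in> Hom K (stage X (\<phi> n)) (stage Y n)) \<and>
        (\<forall>n\<ge>1. \<forall>m\<ge>n.
           Comp K (stage X (\<phi> m)) (stage Y m) (stage Y n) (bond Y m n) (f m) =
           Comp K (stage X (\<phi> m)) (stage X (\<phi> n)) (stage Y n) (f n) (bond X (\<phi> m) (\<phi> n)))}"

definition premor_rel ::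
  "('o, 'm) category \<Rightarrow> ('o, 'm) inv_sys \<Rightarrow> ('o, 'm) inv_sys \<Rightarrow> 'm premor rel" where
  "premor_rel K X Y =
     {((\<phi>, f), (\<phi>', f')).
        (\<phi>, f) \<in> premorphisms K X Y \<and> (\<phi>', f') \<in> premorphisms K X Y \<and>
        (\<forall>n\<ge>1. \<exists>r. r \<ge> \<phi> n \<and> r \<ge> \<phi>' n \<and>
           Comp K (stage X r) (stage X (\<phi> n)) (stage Y n) (f n) (bond X r (\<phi> n)) =
           Comp K (stage X r) (stage X (\<phi>' n)) (stage Y n) (f' n) (bond X r (\<phi>' n)))}"

definition premor_ident :: "('o, 'm) category \<Rightarrow> ('o, 'm) inv_sys \<Rightarrow> 'm premor" where
  "premor_ident K X = (id, \<lambda>n. Ident K (stage X n))"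

fun premor_comp ::
  "('o, 'm) category \<Rightarrow> ('o, 'm) inv_sys \<Rightarrow> ('o, 'm) inv_sys \<Rightarrow> ('o, 'm) inv_sys
     \<Rightarrow> 'm premor \<Rightarrow> 'm premor \<Rightarrow> 'm premor" where
  "premor_comp K X Y Z (\<psi>, g) (\<phi>, f) =
     (\<phi> \<circ> \<psi>, \<lambda>n. Comp K (stage X (\<phi> (\<psi> n))) (stage Y (\<psi> n)) (stage Z n) (g n) (f (\<psi> n)))"

definition Pro :: "('o, 'm) category \<Rightarrow> (('o, 'm) inv_sys, 'm premor set) category" where
  "Pro K =
     \<lparr> Obj = inverse_systems K,
       Hom = (\<lambda>X Y. premorphisms K X Y // premor_rel K X Y),
       Ident = (\<lambda>X. premor_rel K X X `` {premor_ident K X}),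
       Comp = (\<lambda>X Y Z G F. \<Union>g\<in>G. \<Union>f\<in>F. premor_rel K X Z `` {premor_comp K X Y Z g f}) \<rparr>"


section \<open>The category of countable multigraphs and epimorphisms\<close>

text \<open>
  Maps between m-graphs are extensional functions (arbitrary but fixed outside the vertex and arc
  sets), so that equality of arrows is equality of graph maps. Each choice of the vertex and arc types gives a
  full subcategory of the category of all countable m-graphs.
\<close>

definition mGraphEpi :: "(('v, 'e) pre_digraph, ('v \<Rightarrow> 'v) \<times> ('e \<Rightarrow> 'e)) category" where
  "mGraphEpi =
     \<lparr> Obj = {G. wf_digraph G \<and> countable (verts G) \<and> countable (arcs G)},
       Hom = (\<lambda>G H. {(u, w).
          u \<in> verts G \<rightarrow>\<^sub>E verts H \<and> w \<in> arcs G \<rightarrow>\<^sub>E arcs H \<and>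
          (\<forall>e\<in>arcs G. tail H (w e) = u (tail G e) \<and> head H (w e) = u (head G e)) \<and>
          u ` verts G = verts H \<and> w ` arcs G = arcs H}),
       Ident = (\<lambda>G. (\<lambda>v\<in>verts G. v, \<lambda>e\<in>arcs G. e)),
       Comp = (\<lambda>G H J (u', w') (u, w). (compose (verts G) u' u, compose (arcs G) w' w)) \<rparr>"

lemma compose_im: "f ` A = B \<Longrightarrow> g ` B = C \<Longrightarrow> compose A g f ` A = C"
  by (auto simp: compose_def)
lemma compose_PiE: "f \<in> A \<rightarrow>\<^sub>E B \<Longrightarrow> g \<in> B \<rightarrow>\<^sub>E C \<Longrightarrow> compose A g f \<in> A \<rightarrow>\<^sub>E C"
  by (auto simp: compose_def PiE_def Pi_def)

lemma is_category_mGraphEpi: "is_category mGraphEpi"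
  unfolding is_category_def
proof (intro conjI ballI)
  fix G :: "('a,'b) pre_digraph" assume "G \<in> Obj mGraphEpi"
  then show "Ident mGraphEpi G \<in> Hom mGraphEpi G G"
    by (auto simp: mGraphEpi_def wf_digraph_def)
next
  fix G H J :: "('a,'b) pre_digraph" and f g
  assume o: "G \<in> Obj mGraphEpi" and f: "f \<in> Hom mGraphEpi G H" and g: "g \<in> Hom mGraphEpi H J"
  obtain u w where f': "f = (u,w)" by force
  obtain u' w' where g': "g = (u',w')" by force
  have u: "u \<in> verts G \<rightarrow>\<^sub>E verts H" "u ` verts G = verts H" "w \<in> arcs G \<rightarrow>\<^sub>E arcs H" "w ` arcs G = arcs H"
     "\<forall>e\<in>arcs G. tail H (w e) = u (tail G e) \<and> head H (w e) = u (head G e)"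
    using f by (simp_all add: f' mGraphEpi_def)
  have v: "u' \<in> verts H \<rightarrow>\<^sub>E verts J" "u' ` verts H = verts J" "w' \<in> arcs H \<rightarrow>\<^sub>E arcs J" "w' ` arcs H = arcs J"
     "\<forall>e\<in>arcs H. tail J (w' e) = u' (tail H e) \<and> head J (w' e) = u' (head H e)"
    using g by (simp_all add: g' mGraphEpi_def)
  have "wf_digraph G" using o by (simp add: mGraphEpi_def)
  then have "\<forall>e\<in>arcs G. tail J (compose (arcs G) w' w e) = compose (verts G) u' u (tail G e)
     \<and> head J (compose (arcs G) w' w e) = compose (verts G) u' u (head G e)"
    using u v PiE_mem[OF u(3)] by (simp add: compose_eq wf_digraph_def)
  then show "Comp mGraphEpi G H J g f \<in> Hom mGraphEpi G J"
    using u v by (simp add: f' g' mGraphEpi_def compose_im[of _ _ _ _ "verts J"] compose_im[of _ _ _ _ "arcs J"] compose_PiE)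
next
  fix G H :: "('a,'b) pre_digraph" and f
  assume f: "f \<in> Hom mGraphEpi G H"
  then show "Comp mGraphEpi G G H f (Ident mGraphEpi G) = f"
    "Comp mGraphEpi G H H (Ident mGraphEpi H) f = f"
    by (auto simp: mGraphEpi_def PiE_def compose_Id Id_compose)
next
  fix F G H J :: "('a,'b) pre_digraph" and f g h
  assume f: "f \<in> Hom mGraphEpi F G" 
  then show "Comp mGraphEpi F G J (Comp mGraphEpi G H J h g) f = Comp mGraphEpi F H J h (Comp mGraphEpi F G H g f)"
    by (cases f; cases g; cases h) (auto simp: mGraphEpi_def PiE_def compose_assoc)
qed


section \<open>The inverse system of a weighted tree\<close>

text \<open>\<open>Loop d\<close> is the loop at the vertex of \<open>d\<close>; \<open>Arc d e\<close> is the copy of the pair \<open>(d, e) \<in> E\<close>.\<close>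

datatype 'd label = Loop 'd | Arc 'd 'd

primrec label_src :: "'d label \<Rightarrow> 'd" where
  "label_src (Loop d) = d"
| "label_src (Arc d e) = d"

primrec label_tgt :: "'d label \<Rightarrow> 'd" where
  "label_tgt (Loop d) = d"
| "label_tgt (Arc d e) = e"

definition Gamma_graph ::
  "'d set \<Rightarrow> 'd rel \<Rightarrow> (nat \<Rightarrow> 'd) \<Rightarrow> ('d \<Rightarrow> nat) \<Rightarrow> nat \<Rightarrow> (nat list, 'd label) pre_digraph" where
  "Gamma_graph D E enum a n =
     \<lparr> verts = {s \<in> wtree D enum a. length s = n},
       arcs = {Loop d | d. d \<in> D} \<union> {Arc d e | d e. d \<in> D \<and> e \<in> D \<and> d \<noteq> e \<and> (d, e) \<in> E},
       tail = (\<lambda>l. restr (zbr enum (label_src l)) n),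
       head = (\<lambda>l. restr (zbr enum (label_tgt l)) n) \<rparr>"

definition Gamma_sys ::
  "'d set \<Rightarrow> 'd rel \<Rightarrow> (nat \<Rightarrow> 'd) \<Rightarrow> ('d \<Rightarrow> nat) \<Rightarrow>
     ((nat list, 'd label) pre_digraph, (nat list \<Rightarrow> nat list) \<times> ('d label \<Rightarrow> 'd label)) inv_sys" where
  "Gamma_sys D E enum a =
     \<lparr> stage = Gamma_graph D E enum a,
       bond = (\<lambda>m n. (\<lambda>s\<in>verts (Gamma_graph D E enum a m). take n s,
                      \<lambda>l\<in>arcs (Gamma_graph D E enum a m). l)) \<rparr>"

lemma length_restr [simp]: "length (restr x n) = n" by (simp add: restr_def)
lemma take_restr: "n \<le> m \<Longrightarrow> take n (restr x m) = restr x n" by (simp add: restr_def take_map)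
lemma restr_zbr_in: "restr (zbr enum d) n \<in> wtree D enum a"
  by (auto simp: wtree_def restr_def zbr_def)
lemma Gamma_verts_image: assumes "n \<le> m"
  shows "take n ` verts (Gamma_graph D E enum a m) = verts (Gamma_graph D E enum a n)"
proof safe
  fix s assume "s \<in> verts (Gamma_graph D E enum a m)"
  then have s: "s \<in> wtree D enum a" "length s = m" by (simp_all add: Gamma_graph_def)
  consider "s \<in> lists {k. even k}" | x d r k where "d \<in> D" "r \<ge> 2" "x \<in> block enum a d r" "s = restr x k"
    using s(1) unfolding wtree_def by blast
  then have "take n s \<in> wtree D enum a"
  proof cases
    case 1 then have "take n s \<in> lists {k. even k}" by (auto dest: in_set_takeD)
    then show ?thesis by (simp add: wtree_def)
  next
    case 2 then have "take n s = restr x n" using s(2) assms by (simp add: take_restr)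
    then show ?thesis using 2 unfolding wtree_def by blast
  qed
  then show "take n s \<in> verts (Gamma_graph D E enum a n)" using s assms by (simp add: Gamma_graph_def)
next
  fix s assume "s \<in> verts (Gamma_graph D E enum a n)"
  then have s: "s \<in> wtree D enum a" "length s = n" by (simp_all add: Gamma_graph_def)
  consider "s \<in> lists {k. even k}" | x d r k where "d \<in> D" "r \<ge> 2" "x \<in> block enum a d r" "s = restr x k"
    using s(1) unfolding wtree_def by blast
  then have "\<exists>t. t \<in> wtree D enum a \<and> length t = m \<and> take n t = s"
  proof cases
    case 1
    then have "s @ replicate (m - n) 0 \<in> lists {k. even k}" by auto
    then show ?thesis using s assms
      by (intro exI[of _ "s @ replicate (m - n) 0"]) (simp add: wtree_def)
  next
    case 2 then have "restr x m \<in> wtree D enum a" unfolding wtree_def by blast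
    then show ?thesis using 2 s assms by (intro exI[of _ "restr x m"]) (simp add: take_restr)
  qed
  then show "s \<in> take n ` verts (Gamma_graph D E enum a m)" by (force simp: Gamma_graph_def)
qed

lemma Gamma_graph_Obj:
  assumes "bij_betw enum UNIV D"
  shows "Gamma_graph D E enum a n \<in> Obj mGraphEpi"
proof -
  have D: "countable D" using assms bij_betw_imp_surj_on by blast
  have "countable (Loop ` D \<union> (\<lambda>(d,e). Arc d e) ` (D \<times> D))" using D by blast
  then have "countable (arcs (Gamma_graph D E enum a n))"
    by (rule countable_subset[rotated]) (auto simp: Gamma_graph_def)
  then show ?thesis
    by (simp add: mGraphEpi_def Gamma_graph_def wf_digraph_def restr_zbr_in)
qed

lemma Gamma_bond_Hom:
  assumes "n \<le> m"
  shows "bond (Gamma_sys D E enum a) m n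
           \<in> Hom mGraphEpi (Gamma_graph D E enum a m) (Gamma_graph D E enum a n)"
proof -
  have "arcs (Gamma_graph D E enum a m) = arcs (Gamma_graph D E enum a n)"
    by (simp add: Gamma_graph_def)
  moreover have "tail (Gamma_graph D E enum a m) l \<in> verts (Gamma_graph D E enum a m)"
     "head (Gamma_graph D E enum a m) l \<in> verts (Gamma_graph D E enum a m)" 
     "take n (tail (Gamma_graph D E enum a m) l) = tail (Gamma_graph D E enum a n) l"
     "take n (head (Gamma_graph D E enum a m) l) = head (Gamma_graph D E enum a n) l" for l
    using assms by (simp_all add: Gamma_graph_def restr_zbr_in take_restr)
  ultimately show ?thesis
    using Gamma_verts_image[OF assms, of D E enum a] by (auto simp: Gamma_sys_def mGraphEpi_def)
qed

lemma Gamma_sys_Obj: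
  assumes "bij_betw enum UNIV D"
  shows "Gamma_sys D E enum a \<in> Obj (Pro mGraphEpi)"
proof -
  let ?G = "Gamma_graph D E enum a" and ?S = "Gamma_sys D E enum a"
  have st: "stage ?S = ?G" by (simp add: Gamma_sys_def)
  have ar: "arcs (?G m) = arcs (?G n)" for m n by (simp add: Gamma_graph_def)
  have "bond ?S n n = Ident mGraphEpi (?G n)" for n
    by (auto simp: Gamma_sys_def mGraphEpi_def Gamma_graph_def restrict_def fun_eq_iff)
  moreover have "Comp mGraphEpi (?G l) (?G m) (?G n) (bond ?S m n) (bond ?S l m) = bond ?S l n"
    if "n \<le> m" "m \<le> l" for l m n
    using that Gamma_verts_image[OF that(2), of D E enum a] ar[of l m]
    by (auto simp: Gamma_sys_def mGraphEpi_def compose_def fun_eq_iff restrict_def min_def)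
  ultimately show ?thesis
    using Gamma_graph_Obj[OF assms, of E a] Gamma_bond_Hom[of _ _ D E enum a]
    unfolding Pro_def inverse_systems_def by (simp only: category.simps mem_Collect_eq st) blast
qed

end

theory Submission
  imports Defs
begin

text \<open>
  A block over \<open>d\<close> of weight \<open>w\<close> is a union of \<open>2 ^ w\<close> binary Cantor sets, so absorbing the first \<open>k\<close>
  binary choices into the spike identifies it with a block of weight \<open>w + k\<close> at the cost of \<open>k\<close> levels.
  If weights differ by at most \<open>M\<close> along \<open>\<pi>\<close>, these identifications glue to a bijection of the branch
  spaces that shifts levels by at most \<open>M\<close> in both directions; it is \<open>2 ^ M\<close>-bi-Lipschitz and induces an
  isomorphism of inverse systems with index \<open>n \<mapsto> n + M\<close>.

  Conversely, an isomorphism of inverse systems induces a uniform homeomorphism of the branch spaces; the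
  loops and the copied edges force it to act on the branches \<open>z\<^sub>d\<close> by an automorphism \<open>\<pi>\<close>. A uniform
  homeomorphism maps blocks into unions of blocks, since near an even branch some level has infinitely many nodes,
  while a block has finitely many nodes at each level. Counting the nodes of a block of fixed level over
  \<open>\<pi> d\<close> then bounds \<open>a' (\<pi> d) - a d\<close> by a constant determined by the moduli of uniform continuity.
\<close>

section \<open>Maps of branch spaces in terms of initial segments\<close>

lemma restr_eq_iff: "restr x n = restr y n \<longleftrightarrow> (\<forall>i<n. x i = y i)"
  by (auto simp: restr_def)

lemma restr_eq_mono: "restr x m = restr y m \<Longrightarrow> n \<le> m \<Longrightarrow> restr x n = restr y n"
  by (simp add: restr_eq_iff)

lemma seq_eqI: "(\<And>n. n \<ge> 1 \<Longrightarrow> restr x n = restr y n) \<Longrightarrow> x = y"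
  by (rule ext) (metis le_add1 lessI plus_1_eq_Suc restr_eq_iff)

text \<open>The distance is a power of 1/2 whose exponent is the first place of difference, so the
  closed balls of radius \<open>(1/2) ^ n\<close> are the cylinders over nodes of level
  \<open>n\<close>. This is how metric statements become statements about initial segments.\<close>

lemma seq_dist_le_iff: "seq_dist x y \<le> (1/2) ^ n \<longleftrightarrow> restr x n = restr y n"
proof (cases "x = y")
  case False
  define j where "j = (LEAST j. x j \<noteq> y j)"
  have "\<exists>j. x j \<noteq> y j"
    using False by blast
  then have j: "x j \<noteq> y j"
    unfolding j_def by (rule LeastI_ex)
  have j': "x i = y i" if "i < j" for i
    using not_less_Least[of i "\<lambda>j. x j \<noteq> y j"] that by (simp add: j_def)
  have "seq_dist x y = (1/2) ^ j"
    using False by (simp add: seq_dist_def j_def)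
  then have "seq_dist x y \<le> (1/2) ^ n \<longleftrightarrow> n \<le> j"
    by (simp add: power_decreasing_iff)
  also have "\<dots> \<longleftrightarrow> restr x n = restr y n"
    unfolding restr_eq_iff using j j' by (meson less_le_trans not_less)
  finally show ?thesis .
qed (simp add: seq_dist_def)

section \<open>Uniformly continuous maps and level-shifting maps\<close>

definition unif_map :: "(nat \<Rightarrow> nat) set \<Rightarrow> (nat \<Rightarrow> nat) set \<Rightarrow> ((nat \<Rightarrow> nat) \<Rightarrow> nat \<Rightarrow> nat) \<Rightarrow> bool" where
  "unif_map A B f \<longleftrightarrow> f \<in> A \<rightarrow> B \<and>
     (\<forall>n. \<exists>m. \<forall>x\<in>A. \<forall>y\<in>A. restr x m = restr y m \<longrightarrow> restr (f x) n = restr (f y) n)"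

text \<open>Uniform continuity with the explicit modulus \<open>n + M\<close>. This one form yields
  both the Lipschitz constant \<open>2 ^ M\<close> and the index map of a pre-morphism.\<close>

definition shift_map ::
  "nat \<Rightarrow> (nat \<Rightarrow> nat) set \<Rightarrow> (nat \<Rightarrow> nat) set \<Rightarrow> ((nat \<Rightarrow> nat) \<Rightarrow> nat \<Rightarrow> nat) \<Rightarrow> bool" where
  "shift_map M A B f \<longleftrightarrow> f \<in> A \<rightarrow> B \<and>
     (\<forall>n. \<forall>x\<in>A. \<forall>y\<in>A. restr x (n + M) = restr y (n + M) \<longrightarrow> restr (f x) n = restr (f y) n)"

definition shift_equiv ::
  "nat \<Rightarrow> (nat \<Rightarrow> nat) set \<Rightarrow> (nat \<Rightarrow> nat) set \<Rightarrow> ((nat \<Rightarrow> nat) \<Rightarrow> nat \<Rightarrow> nat)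
     \<Rightarrow> ((nat \<Rightarrow> nat) \<Rightarrow> nat \<Rightarrow> nat) \<Rightarrow> bool" where
  "shift_equiv M A B f g \<longleftrightarrow> shift_map M A B f \<and> shift_map M B A g \<and>
     (\<forall>x\<in>A. g (f x) = x) \<and> (\<forall>y\<in>B. f (g y) = y)"

lemma shift_mapD:
  assumes "shift_map M A B f"
  shows "x \<in> A \<Longrightarrow> f x \<in> B"
    and "x \<in> A \<Longrightarrow> y \<in> A \<Longrightarrow> restr x (n + M) = restr y (n + M) \<Longrightarrow> restr (f x) n = restr (f y) n"
  using assms unfolding shift_map_def by blast+

lemma unif_mapD:
  assumes "unif_map A B f"
  shows "x \<in> A \<Longrightarrow> f x \<in> B"
    and "\<exists>m. \<forall>x\<in>A. \<forall>y\<in>A. restr x m = restr y m \<longrightarrow> restr (f x) n = restr (f y) n"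
  using assms unfolding unif_map_def by blast+

lemma shift_mapI:
  assumes "\<And>x. x \<in> A \<Longrightarrow> f x \<in> B"
    and "\<And>n x y. x \<in> A \<Longrightarrow> y \<in> A \<Longrightarrow> restr x (n + M) = restr y (n + M) \<Longrightarrow> restr (f x) n = restr (f y) n"
  shows "shift_map M A B f"
  using assms unfolding shift_map_def by blast

lemma shift_equivD:
  assumes "shift_equiv M A B f g"
  shows "shift_map M A B f" "shift_map M B A g" "x \<in> A \<Longrightarrow> g (f x) = x" "y \<in> B \<Longrightarrow> f (g y) = y"
  using assms unfolding shift_equiv_def by blast+

lemma shift_equiv_sym: "shift_equiv M A B f g \<Longrightarrow> shift_equiv M B A g f"
  by (simp add: shift_equiv_def)

lemma shift_map_mono: "shift_map M A B f \<Longrightarrow> M \<le> N \<Longrightarrow> shift_map N A B f"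
  unfolding shift_map_def by (meson add_left_mono restr_eq_mono)

lemma shift_equiv_mono: "shift_equiv M A B f g \<Longrightarrow> M \<le> N \<Longrightarrow> shift_equiv N A B f g"
  unfolding shift_equiv_def by (blast intro: shift_map_mono)

lemma shift_map_comp:
  assumes "shift_map M A B f" "shift_map N B C g"
  shows "shift_map (M + N) A C (g \<circ> f)"
proof (rule shift_mapI)
  fix n x y
  assume "x \<in> A" "y \<in> A" "restr x (n + (M + N)) = restr y (n + (M + N))"
  then show "restr ((g \<circ> f) x) n = restr ((g \<circ> f) y) n"
    using shift_mapD(2)[OF assms(1), of x y "n + N"] shift_mapD(1)[OF assms(1)]
    unfolding o_apply by (intro shift_mapD(2)[OF assms(2)]) (simp_all add: ac_simps)
qed (use shift_mapD(1)[OF assms(1)] shift_mapD(1)[OF assms(2)] in simp)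

lemma shift_equiv_comp:
  assumes "shift_equiv M A B f g" "shift_equiv N B C f' g'"
  shows "shift_equiv (M + N) A C (f' \<circ> f) (g \<circ> g')"
proof -
  note fg = shift_equivD[OF assms(1)] and fg' = shift_equivD[OF assms(2)]
  have "shift_map (M + N) C A (g \<circ> g')"
    using shift_map_comp[OF fg'(2) fg(2)] by (simp add: add.commute)
  then show ?thesis
    using shift_map_comp[OF fg(1) fg'(1)] fg(3,4) fg'(3,4)
      shift_mapD(1)[OF fg(1)] shift_mapD(1)[OF fg'(2)]
    by (simp add: shift_equiv_def)
qed

text \<open>If the points first differ at a place \<open>j \<ge> M\<close>, their images agree up to
  level \<open>j - M\<close>, which costs the factor \<open>2 ^ M\<close>. If \<open>j < M\<close>,
  the right-hand side is at least 1, and no distance exceeds 1.\<close>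

lemma shift_map_Lipschitz:
  assumes "shift_map M A B f" "x \<in> A" "y \<in> A"
  shows "seq_dist (f x) (f y) \<le> 2 ^ M * seq_dist x y"
proof (cases "x = y")
  case False
  define j where "j = (LEAST j. x j \<noteq> y j)"
  have d: "seq_dist x y = (1/2) ^ j"
    using False by (simp add: seq_dist_def j_def)
  then have "restr x j = restr y j"
    by (simp flip: seq_dist_le_iff)
  show ?thesis
  proof (cases "M \<le> j")
    case True
    then have "restr (f x) (j - M) = restr (f y) (j - M)"
      using \<open>restr x j = restr y j\<close> by (intro shift_mapD(2)[OF assms]) simp
    then have "seq_dist (f x) (f y) \<le> (1/2) ^ (j - M)"
      by (simp add: seq_dist_le_iff)
    also have "\<dots> = 2 ^ M * (1/2) ^ j"
      using True by (simp add: power_one_over field_simps flip: power_add)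
    finally show ?thesis by (simp add: d)
  next
    case False
    have "seq_dist (f x) (f y) \<le> (1/2) ^ 0"
      unfolding seq_dist_le_iff by (simp add: restr_def)
    also have "\<dots> \<le> 2 ^ M * (1/2::real) ^ j"
      using False by (simp add: power_one_over field_simps)
    finally show ?thesis by (simp add: d)
  qed
qed (simp add: seq_dist_def)

text \<open>Both radii in the definition of uniform continuity may be taken to be powers of 1/2,
  since every positive real number exceeds one of them; for such radii the condition speaks of
  initial segments.\<close>

lemma unif_map_iff_uniformly_continuous:
  "uniformly_continuous_map (branch_space S) (branch_space T) f
     \<longleftrightarrow> unif_map (branches S) (branches T) f" (is "?L \<longleftrightarrow> ?R")
proof
  assume L: ?L
  have "\<exists>m. \<forall>x\<in>branches S. \<forall>y\<in>branches S. restr x m = restr y m \<longrightarrow> restr (f x) n = restr (f y) n" for n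
  proof -
    obtain \<delta> where \<delta>: "\<delta> > 0"
      "\<And>x y. x \<in> branches S \<Longrightarrow> y \<in> branches S \<Longrightarrow> seq_dist y x < \<delta> \<Longrightarrow> seq_dist (f y) (f x) < (1/2) ^ n"
      using L unfolding uniformly_continuous_map_def by (metis mdist_branch_space mspace_branch_space
          zero_less_power half_gt_zero_iff zero_less_one)
    obtain m where m: "(1/2::real) ^ m < \<delta>"
      using real_arch_pow_inv[OF \<delta>(1)] by force
    have "restr (f x) n = restr (f y) n" if "x \<in> branches S" "y \<in> branches S" "restr x m = restr y m" for x y
      using \<delta>(2)[OF that(2,1)] that(3) m by (simp flip: seq_dist_le_iff)
    then show ?thesis by blast
  qed
  moreover have "f \<in> branches S \<rightarrow> branches T"
    using L by (simp add: uniformly_continuous_map_def)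
  ultimately show ?R
    unfolding unif_map_def by blast
next
  assume R: ?R
  have "\<exists>\<delta>>0. \<forall>x\<in>branches S. \<forall>y\<in>branches S. seq_dist y x < \<delta> \<longrightarrow> seq_dist (f y) (f x) < \<epsilon>"
    if "\<epsilon> > 0" for \<epsilon> :: real
  proof -
    obtain n where n: "(1/2::real) ^ n < \<epsilon>"
      using real_arch_pow_inv[OF \<open>\<epsilon> > 0\<close>] by force
    obtain m where m: "\<And>x y. x \<in> branches S \<Longrightarrow> y \<in> branches S \<Longrightarrow> restr x m = restr y m
        \<Longrightarrow> restr (f x) n = restr (f y) n"
      using R unfolding unif_map_def by meson
    show ?thesis
    proof (intro exI[of _ "(1/2) ^ m"] conjI ballI impI)
      fix x y assume "x \<in> branches S" "y \<in> branches S" "seq_dist y x < (1/2) ^ m"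
      then have "restr (f y) n = restr (f x) n"
        by (intro m) (simp_all flip: seq_dist_le_iff)
      then show "seq_dist (f y) (f x) < \<epsilon>"
        using n by (simp flip: seq_dist_le_iff)
    qed simp
  qed
  moreover have "f \<in> branches S \<rightarrow> branches T"
    using R unfolding unif_map_def by blast
  ultimately show ?L
    unfolding uniformly_continuous_map_def by simp
qed

text \<open>The upper bound makes \<open>h\<close> Lipschitz and the lower bound makes its inverse
  Lipschitz; Lipschitz maps are uniformly continuous, hence continuous.\<close>

lemma bij_Lipschitz_uniform_homeomorphism:
  assumes bij: "bij_betw h (mspace X) (mspace Y)" and "L > 0"
    and lip: "\<And>x y. x \<in> mspace X \<Longrightarrow> y \<in> mspace X \<Longrightarrow>
      inverse L * mdist X x y \<le> mdist Y (h x) (h y) \<and> mdist Y (h x) (h y) \<le> L * mdist X x y"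
  shows "uniform_homeomorphism X Y h" "homeomorphic_map (mtopology_of X) (mtopology_of Y) h"
proof -
  let ?k = "inv_into (mspace X) h"
  have k: "?k \<in> mspace Y \<rightarrow> mspace X" "\<And>y. y \<in> mspace Y \<Longrightarrow> h (?k y) = y"
    using bij by (auto simp: bij_betw_def inv_into_into f_inv_into_f)
  have "Lipschitz_continuous_map X Y h"
    using bij lip unfolding Lipschitz_continuous_map_def by (auto simp: bij_betw_def)
  then have h: "uniformly_continuous_map X Y h"
    by (rule Lipschitz_imp_uniformly_continuous_map)
  have "mdist X (?k x) (?k y) \<le> L * mdist Y x y" if "x \<in> mspace Y" "y \<in> mspace Y" for x y
    using lip[of "?k x" "?k y"] k that \<open>L > 0\<close> by (auto simp: field_simps)
  then have "Lipschitz_continuous_map Y X ?k"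
    using k unfolding Lipschitz_continuous_map_def by auto
  then have k': "uniformly_continuous_map Y X ?k"
    by (rule Lipschitz_imp_uniformly_continuous_map)
  show "uniform_homeomorphism X Y h"
    using h k' bij by (simp add: uniform_homeomorphism_def)
  have "homeomorphic_maps (mtopology_of X) (mtopology_of Y) h ?k"
    using h k' bij k(2) by (auto simp: homeomorphic_maps_def bij_betw_def
        intro: uniformly_continuous_imp_continuous_map)
  then show "homeomorphic_map (mtopology_of X) (mtopology_of Y) h"
    by (rule homeomorphic_maps_map[THEN iffD1, THEN conjunct1])
qed

lemma bi_Lipschitz_imp_uniform_homeomorphism:
  assumes "bi_Lipschitz_homeo X Y h"
  shows "uniform_homeomorphism X Y h"
proof -
  obtain L where L: "bi_Lipschitz_homeo_with L X Y h"
    using assms by (auto simp: bi_Lipschitz_homeo_def)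
  then have "bij_betw h (mspace X) (mspace Y)"
    using homeomorphic_imp_injective_map[of "mtopology_of X" "mtopology_of Y" h]
      homeomorphic_imp_surjective_map[of "mtopology_of X" "mtopology_of Y" h]
    by (simp add: bi_Lipschitz_homeo_with_def bij_betw_def)
  then show ?thesis
    using L by (intro bij_Lipschitz_uniform_homeomorphism(1)[of h X Y L])
      (auto simp: bi_Lipschitz_homeo_with_def)
qed

text \<open>The lower bound for \<open>h\<close> is the upper bound for the inverse
  \<open>k\<close>, taken at \<open>h x\<close> and \<open>h y\<close>.\<close>

lemma shift_equiv_bi_Lipschitz:
  assumes "shift_equiv M (branches S) (branches T) h k"
  shows "bi_Lipschitz_homeo_with (2 ^ M) (branch_space S) (branch_space T) h"
proof -
  note sh = shift_equivD[OF assms]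
  have bij: "bij_betw h (branches S) (branches T)"
    using sh shift_mapD(1) by (intro bij_betw_byWitness[of _ k]) blast+
  have lip: "inverse (2 ^ M) * seq_dist x y \<le> seq_dist (h x) (h y) \<and>
      seq_dist (h x) (h y) \<le> 2 ^ M * seq_dist x y" if "x \<in> branches S" "y \<in> branches S" for x y
    using shift_map_Lipschitz[OF sh(1) that] shift_map_Lipschitz[OF sh(2), of "h x" "h y"]
      that sh(3) shift_mapD(1)[OF sh(1)] by (auto simp: field_simps)
  show ?thesis
    unfolding bi_Lipschitz_homeo_with_def
    using bij_Lipschitz_uniform_homeomorphism(2)[of h "branch_space S" "branch_space T" "2 ^ M"] bij lip
    by auto
qed

section \<open>Branches and blocks\<close>

lemma branches_restr: "x \<in> branches T \<Longrightarrow> restr x n \<in> T"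
  by (simp add: branches_def)

text \<open>A block with stem, spike level and weight as independent parameters, so that the weight
  can be raised one unit at a time without reference to a vertex.\<close>

definition fan :: "(nat \<Rightarrow> nat) \<Rightarrow> nat \<Rightarrow> nat \<Rightarrow> (nat \<Rightarrow> nat) set" where
  "fan z r w = {x. restr x r = restr z r \<and> (\<exists>q < 2 ^ w. x r = 2 * q + 1) \<and> (\<forall>s>r. x s \<in> {1, 3})}"

lemma block_eq_fan: "block enum a d r = fan (zbr enum d) r (a d)"
proof -
  have "(\<forall>s. x (r + s + 1) \<in> {1, 3}) \<longleftrightarrow> (\<forall>s>r. x s \<in> {1, 3})" for x :: "nat \<Rightarrow> nat"
    by (metis add.assoc add.commute less_add_one less_iff_succ_less_eq less_imp_add_positive
        Suc_eq_plus1 add_Suc_right less_natE le_add1 le_imp_less_Suc)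
  then show ?thesis
    by (auto simp: block_def fan_def)
qed

text \<open>All points of a fan share their first \<open>r\<close> coordinates, so overwriting these
  loses no information and costs no level.\<close>

lemma fan_change_stem: "\<exists>f g. shift_equiv 0 (fan z r w) (fan z' r w) f g"
proof -
  define c where "c = (\<lambda>z x j. if j < r then z j else x j :: nat)"
  have c: "shift_map 0 (fan z r w) (fan z' r w) (c z')" for z z'
    by (rule shift_mapI) (auto simp: c_def fan_def restr_eq_iff)
  have "c z (c z' x) = x" if "x \<in> fan z r w" for x z z'
    using that by (auto simp: c_def fan_def restr_eq_iff)
  then have "shift_equiv 0 (fan z r w) (fan z' r w) (c z') (c z)"
    using c unfolding shift_equiv_def by blast
  then show ?thesis by blast
qed

text \<open>Absorbing the first binary choice after the spike \<open>2q + 1\<close> into \<open>q\<close> doubles the width of the fan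
  at the cost of one level.\<close>

lemma fan_double: "\<exists>f g. shift_equiv 1 (fan z r w) (fan z r (Suc w)) f g"
proof -
  \<comment> \<open>If \<open>x r = 2 * q + 1\<close> and \<open>x (r + 1) = 2 * b + 1\<close>, the
    new spike is \<open>2 * (2 * q + b) + 1\<close>; the later coordinates move down by one
    place.\<close>
  define f where "f = (\<lambda>x j. if j < r then x j else if j = r then 2 * x r + x (r + 1) - 2 else x (j + 1) :: nat)"
  \<comment> \<open>Division of the spike \<open>2 * (2 * q + b) + 1\<close> by 4 gives back
    \<open>q\<close>, and the remainder \<open>2 * b + 1\<close> is already the value 1 or 3 to be
    reinserted.\<close>
  define g where "g = (\<lambda>y j. if j < r then y j else if j = r then 2 * (y r div 4) + 1
     else if j = r + 1 then y r mod 4 else y (j - 1) :: nat)"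
  have x: "\<exists>q b. q < 2 ^ w \<and> b < 2 \<and> x r = 2 * q + 1 \<and> x (r + 1) = 2 * b + 1"
    if "x \<in> fan z r w" for x
  proof -
    have "x (r + 1) \<in> {1, 3}" using that by (auto simp: fan_def)
    then have "\<exists>b<2. x (r + 1) = 2 * b + 1" by (auto simp: numeral_3_eq_3 intro: exI[of _ 0] exI[of _ 1])
    then show ?thesis using that by (auto simp: fan_def)
  qed
  have y: "\<exists>q b. q < 2 ^ w \<and> b < 2 \<and> y r = 2 * (2 * q + b) + 1"
    if yF: "y \<in> fan z r (Suc w)" for y
  proof -
    obtain p where "p < 2 ^ Suc w" "y r = 2 * p + 1" using yF unfolding fan_def by blast
    then show ?thesis
      by (intro exI[of _ "p div 2"] exI[of _ "p mod 2"]) auto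
  qed
  have "f x \<in> fan z r (Suc w)" "g (f x) = x" if xF: "x \<in> fan z r w" for x
  proof -
    obtain q b where q: "q < 2 ^ w" "b < 2" "x r = 2 * q + 1" "x (r + 1) = 2 * b + 1"
      using x[OF xF] by blast
    then have fr: "f x r = 2 * (2 * q + b) + 1" by (simp add: f_def)
    have "2 * q + b < 2 ^ Suc w" using q by simp
    then show "f x \<in> fan z r (Suc w)"
      using that fr by (auto simp: fan_def restr_eq_iff f_def)
    have "(2 * (2 * q + b) + 1) div 4 = q" "(2 * (2 * q + b) + 1) mod 4 = 2 * b + 1"
      using q(2) by presburger+
    then show "g (f x) = x"
      using q fr by (auto simp: g_def fun_eq_iff) (auto simp: f_def)
  qed
  moreover have "g y \<in> fan z r w" "f (g y) = y" if yF: "y \<in> fan z r (Suc w)" for y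
  proof -
    obtain q b where q: "q < 2 ^ w" "b < 2" "y r = 2 * (2 * q + b) + 1"
      using y[OF yF] by blast
    then have d: "y r div 4 = q" "y r mod 4 = 2 * b + 1"
      by presburger+
    have b: "2 * b + 1 \<in> {1, 3}" using q(2) by auto
    have "g y s \<in> {1, 3}" if "s > r" for s
      using \<open>y \<in> fan z r (Suc w)\<close> that b by (auto simp: fan_def g_def d)
    moreover have "restr (g y) r = restr z r" "g y r = 2 * q + 1"
      using that by (auto simp: fan_def restr_eq_iff g_def d)
    ultimately show "g y \<in> fan z r w"
      using q unfolding fan_def by blast
    show "f (g y) = y"
      using q d by (auto simp: f_def fun_eq_iff) (auto simp: g_def)
  qed
  \<comment> \<open>The value \<open>f x j\<close> reads coordinates of \<open>x\<close> up to
    \<open>j + 1\<close>, and \<open>g y j\<close> reads coordinates of \<open>y\<close> up to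
    \<open>j\<close>, so one additional level suffices in both directions.\<close>
  moreover have "restr (f x) n = restr (f y) n" if "restr x (n + 1) = restr y (n + 1)" for x y n
    using that by (auto simp: restr_eq_iff f_def)
  moreover have "restr (g x) n = restr (g y) n" if "restr x (n + 1) = restr y (n + 1)" for x y n
    using that by (auto simp: restr_eq_iff g_def)
  ultimately have "shift_equiv 1 (fan z r w) (fan z r (Suc w)) f g"
    unfolding shift_equiv_def by (intro conjI ballI shift_mapI)
  then show ?thesis by blast
qed

text \<open>Induction on \<open>k\<close>: the base case changes the stem for free, and each step
  doubles the width once, adding one level.\<close>

lemma fan_widen: "\<exists>f g. shift_equiv k (fan z r w) (fan z' r (w + k)) f g"
proof (induction k)
  case 0
  then show ?case using fan_change_stem[of z r w z'] by simp
next
  case (Suc k)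
  then show ?case
    using fan_double[of z' r "w + k"] shift_equiv_comp[where M = k and N = 1] by fastforce
qed

text \<open>The smaller weight is raised to the larger one; if \<open>w\<close> is the larger, the
  equivalence is read backwards. Monotonicity in the shift then gives the common bound
  \<open>M\<close>.\<close>

lemma fan_shift_equiv:
  assumes "\<bar>int w - int w'\<bar> \<le> int M"
  shows "\<exists>f g. shift_equiv M (fan z r w) (fan z' r w') f g"
proof (cases "w \<le> w'")
  case True
  then obtain f g where "shift_equiv (w' - w) (fan z r w) (fan z' r w') f g"
    using fan_widen[of "w' - w" z r w z'] by auto
  then show ?thesis
    using shift_equiv_mono[of "w' - w" _ _ f g M] assms by fastforce
next
  case False
  then obtain f g where "shift_equiv (w - w') (fan z' r w') (fan z r w) f g"
    using fan_widen[of "w - w'" z' r w' z] by auto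
  then have "shift_equiv (w - w') (fan z r w) (fan z' r w') g f"
    by (rule shift_equiv_sym)
  then show ?thesis
    using shift_equiv_mono[of "w - w'" _ _ g f M] assms by fastforce
qed

section \<open>The branches of a weighted tree\<close>

locale enumerated =
  fixes D :: "'d set" and enum :: "nat \<Rightarrow> 'd"
  assumes enum: "bij_betw enum UNIV D"
begin

abbreviation z :: "'d \<Rightarrow> nat \<Rightarrow> nat" where "z \<equiv> zbr enum"
abbreviation brs :: "('d \<Rightarrow> nat) \<Rightarrow> (nat \<Rightarrow> nat) set" where "brs a \<equiv> branches (wtree D enum a)"

lemma enum_in [simp]: "enum i \<in> D"
  using enum by (auto simp: bij_betw_def)

lemma inv_enum [simp]: "inv enum (enum i) = i"
  using enum by (simp add: bij_betw_def)

lemma enum_inv [simp]: "d \<in> D \<Longrightarrow> enum (inv enum d) = d"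
  using enum by (simp add: bij_betw_def f_inv_into_f)

lemma z_0: "d \<in> D \<Longrightarrow> enum (z d 0 div 2) = d"
  by (simp add: zbr_def)

lemma even_z [simp]: "even (z d n)"
  by (simp add: zbr_def)

lemma z_inject: "d \<in> D \<Longrightarrow> e \<in> D \<Longrightarrow> z d = z e \<longleftrightarrow> d = e"
  by (metis z_0)

lemma block_even: "x \<in> block enum a d r \<Longrightarrow> i < r \<Longrightarrow> x i = z d i"
  by (simp add: block_eq_fan fan_def restr_eq_iff)

lemma block_odd: "x \<in> block enum a d r \<Longrightarrow> i \<ge> r \<Longrightarrow> odd (x i)"
  by (cases "i = r") (auto simp: block_eq_fan fan_def dest!: spec[of _ i])

text \<open>Passing to infinite branches adds nothing new: beyond the first odd coordinate
  \<open>r\<close> of \<open>x\<close>, every initial segment of \<open>x\<close> comes from some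
  block whose spike is also at \<open>r\<close>, because parity locates the spike.\<close>

lemma brs_iff: "x \<in> brs a \<longleftrightarrow> (\<forall>n. even (x n)) \<or> (\<exists>d\<in>D. \<exists>r\<ge>2. x \<in> block enum a d r)"
proof
  assume x: "x \<in> brs a"
  show "(\<forall>n. even (x n)) \<or> (\<exists>d\<in>D. \<exists>r\<ge>2. x \<in> block enum a d r)"
  proof (cases "\<forall>n. even (x n)")
    case False
    define r where "r = (LEAST r. odd (x r))"
    have r: "odd (x r)" "\<And>i. i < r \<Longrightarrow> even (x i)"
      using False LeastI_ex[of "\<lambda>r. odd (x r)"] not_less_Least[of _ "\<lambda>r. odd (x r)"]
      unfolding r_def by blast+
    have *: "\<exists>d\<in>D. r \<ge> 2 \<and> (\<exists>y. y \<in> block enum a d r \<and> restr x n = restr y n)" if "n > r" for n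
    proof -
      have "restr x n \<in> wtree D enum a"
        using x by (rule branches_restr)
      \<comment> \<open>An odd entry keeps the node out of the even part of the tree, so it must
        come from a block.\<close>
      moreover have "x r \<in> set (restr x n)"
        using that by (auto simp: restr_def)
      ultimately obtain y d r' m where y: "d \<in> D" "r' \<ge> 2" "y \<in> block enum a d r'" "restr x n = restr y m"
        using r(1) by (force simp: wtree_def)
      have "m = n" using y(4) length_restr by metis
      then have xy: "\<And>i. i < n \<Longrightarrow> x i = y i" using y(4) by (simp add: restr_eq_iff)
      have "r' = r"
      proof (rule linorder_cases)
        assume "r' < r"
        then show ?thesis using r(2)[of r'] xy[of r'] block_odd[OF y(3), of r'] that by simp
      next
        assume "r < r'"
        then show ?thesis using r(1) xy[of r] block_even[OF y(3), of r] that by simp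
      qed
      then show ?thesis using y \<open>m = n\<close> by blast
    qed
    obtain d y where d: "d \<in> D" "r \<ge> 2" and y: "y \<in> block enum a d r" "restr x (r + 1) = restr y (r + 1)"
      using *[of "r + 1"] by auto
    \<comment> \<open>The witness may come from a block over another vertex for each
      \<open>s\<close>; this is harmless, since its spike is at \<open>r\<close> and the condition
      beyond the spike does not mention the vertex.\<close>
    have "x s \<in> {1, 3}" if s: "s > r" for s
    proof -
      obtain d' y' where "y' \<in> block enum a d' r" "restr x (s + 1) = restr y' (s + 1)"
        using *[of "s + 1"] s by auto
      then show ?thesis using s unfolding block_eq_fan fan_def restr_eq_iff by simp
    qed
    then have "x \<in> block enum a d r"
      using y by (simp add: block_eq_fan fan_def restr_eq_iff)
    then show ?thesis
      using d by blast
  qed simp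
next
  assume "(\<forall>n. even (x n)) \<or> (\<exists>d\<in>D. \<exists>r\<ge>2. x \<in> block enum a d r)"
  then show "x \<in> brs a"
  proof
    assume "\<forall>n. even (x n)"
    then show ?thesis by (auto simp: branches_def wtree_def restr_def)
  next
    assume "\<exists>d\<in>D. \<exists>r\<ge>2. x \<in> block enum a d r"
    then show ?thesis unfolding branches_def wtree_def by blast
  qed
qed

lemma brs_cases [consumes 1, case_names even block]:
  assumes "x \<in> brs a"
  obtains "\<And>n. even (x n)" | d r where "d \<in> D" "r \<ge> 2" "x \<in> block enum a d r"
  using assms brs_iff by blast

lemma z_in_brs [simp]: "z d \<in> brs a"
  by (simp add: brs_iff)

text \<open>The tree has no dead ends: an even node is continued by zeros, any other node by the
  block branch that it comes from.\<close>

lemma wtree_extend: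
  assumes "s \<in> wtree D enum a"
  shows "\<exists>x\<in>brs a. restr x (length s) = s"
proof -
  consider "s \<in> lists {k. even k}" | x d r k where "d \<in> D" "r \<ge> 2" "x \<in> block enum a d r" "s = restr x k"
    using assms unfolding wtree_def by blast
  then show ?thesis
  proof cases
    case 1
    define x where "x = (\<lambda>i. if i < length s then s ! i else 0)"
    have "restr x (length s) = s"
      by (rule nth_equalityI) (simp_all add: restr_def x_def)
    moreover have "even (x i)" for i
      using 1 nth_mem[of i s] by (auto simp: x_def)
    ultimately show ?thesis
      using brs_iff by blast
  next
    case 2
    then have "x \<in> brs a" using brs_iff by blast
    then show ?thesis using 2 by auto
  qed
qed

text \<open>A node that shows the spike fixes the whole block: the change of parity gives the level
  \<open>r\<close>, and coordinate 0, which precedes the spike, gives the vertex. Blocks are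
  therefore open in the branch space.\<close>

lemma block_determined:
  assumes x: "x \<in> block enum a d r" "d \<in> D" "r \<ge> 2" and y: "y \<in> brs a"
    and eq: "restr x n = restr y n" "r < n"
  shows "y \<in> block enum a d r"
proof -
  have xy: "\<And>i. i < n \<Longrightarrow> x i = y i" using eq(1) by (simp add: restr_eq_iff)
  have "odd (y r)" using block_odd[OF x(1), of r] xy[OF eq(2)] by simp
  with y show ?thesis
  proof (cases rule: brs_cases)
    case (block d' r')
    have "r' = r"
    proof (rule linorder_cases)
      assume "r' < r"
      then show ?thesis
        using block_even[OF x(1), of r'] block_odd[OF block(3), of r'] xy[of r'] eq(2) by simp
    next
      assume "r < r'"
      then show ?thesis using \<open>odd (y r)\<close> block_even[OF block(3), of r] by simp
    qed
    moreover have "z d 0 = z d' 0"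
      using block_even[OF x(1), of 0] block_even[OF block(3), of 0] xy[of 0] eq(2) x(3) block(2) by simp
    then have "d = d'"
      using z_0[OF x(2)] z_0[OF block(1)] by metis
    ultimately show ?thesis using block(3) by metis
  next
    case even
    then show ?thesis using \<open>odd (y r)\<close> by blast
  qed
qed

end

section \<open>Gluing maps between blocks\<close>

context enumerated
begin

lemma block_Least_odd: "x \<in> block enum a d r \<Longrightarrow> (LEAST r. odd (x r)) = r"
  by (rule Least_equality) (auto simp: block_odd block_even not_less[symmetric] dest: block_even)

lemma block_0: "x \<in> block enum a d r \<Longrightarrow> d \<in> D \<Longrightarrow> r > 0 \<Longrightarrow> enum (x 0 div 2) = d"
  by (simp add: block_even z_0)

text \<open>The action of \<open>\<pi>\<close> on even branches: the vertex encoded in coordinate 0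
  is renamed and the tail is kept, so that \<open>z d\<close> goes to
  \<open>z (\<pi> d)\<close>.\<close>

definition relabel :: "('d \<Rightarrow> 'd) \<Rightarrow> (nat \<Rightarrow> nat) \<Rightarrow> nat \<Rightarrow> nat" where
  "relabel \<pi> x = x(0 := z (\<pi> (enum (x 0 div 2))) 0)"

text \<open>The index of the block is decoded from the branch itself: coordinate 0 gives the vertex
  and the first odd coordinate the spike level. A family of maps between blocks thus becomes one
  function.\<close>

definition glue :: "('d \<Rightarrow> 'd) \<Rightarrow> ('d \<Rightarrow> nat \<Rightarrow> (nat \<Rightarrow> nat) \<Rightarrow> nat \<Rightarrow> nat) \<Rightarrow> (nat \<Rightarrow> nat) \<Rightarrow> nat \<Rightarrow> nat" where
  "glue \<pi> F x = (if \<forall>n. even (x n) then relabel \<pi> x else F (enum (x 0 div 2)) (LEAST r. odd (x r)) x)"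

lemma glue_even: "(\<And>n. even (x n)) \<Longrightarrow> glue \<pi> F x = relabel \<pi> x"
  by (simp add: glue_def)

lemma glue_block:
  assumes "x \<in> block enum a d r" "d \<in> D" "r \<ge> 2"
  shows "glue \<pi> F x = F d r x"
proof -
  have "odd (x r)" by (rule block_odd[OF assms(1)]) simp
  then show ?thesis
    using block_Least_odd[OF assms(1)] block_0[OF assms(1,2)] assms(3) by (auto simp: glue_def)
qed

lemma relabel_z: "d \<in> D \<Longrightarrow> relabel \<pi> (z d) = z (\<pi> d)"
  unfolding relabel_def by (simp add: z_0) (simp add: zbr_def fun_eq_iff)

lemma relabel_restr: "restr x n = restr y n \<Longrightarrow> restr (relabel \<pi> x) n = restr (relabel \<pi> y) n"
  by (auto simp: restr_eq_iff relabel_def)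

text \<open>Below the spike, a point of a block over \<open>\<pi> d\<close> equals
  \<open>z (\<pi> d)\<close>, which is also what relabelling produces. Hence the choice of
  \<open>F\<close> is invisible before the first odd coordinate; this is what makes the glued map
  continuous across blocks.\<close>

lemma glue_restr_even:
  assumes F: "\<And>d r. d \<in> D \<Longrightarrow> F d r \<in> block enum a d r \<rightarrow> block enum a' (\<pi> d) r"
    and x: "x \<in> brs a" and even: "\<And>i. i < n \<Longrightarrow> even (x i)"
  shows "restr (glue \<pi> F x) n = restr (relabel \<pi> x) n"
  using x
proof (cases rule: brs_cases)
  case even
  then show ?thesis by (simp add: glue_even)
next
  case (block d r)
  have "n \<le> r"
    using assms(3)[of r] block_odd[OF block(3), of r] by fastforce
  have Fx: "F d r x \<in> block enum a' (\<pi> d) r"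
    using F[OF block(1)] block(3) by blast
  have "F d r x i = relabel \<pi> x i" if "i < n" for i
    using block_even[OF Fx, of i] block_even[OF block(3), of i] block_0[OF block(3,1)] that \<open>n \<le> r\<close>
    by (auto simp: relabel_def zbr_def)
  then show ?thesis
    using block by (simp add: glue_block restr_eq_iff)
qed

text \<open>If the common initial segment of two branches contains an odd entry, both lie in the
  same block and the shift property of \<open>F\<close> applies. Otherwise both are even up to level
  \<open>n\<close>, where the glued map is relabelling.\<close>

lemma glue_shift_map:
  assumes \<pi>: "\<pi> \<in> D \<rightarrow> D"
    and F: "\<And>d r. d \<in> D \<Longrightarrow> shift_map M (block enum a d r) (block enum a' (\<pi> d) r) (F d r)"
  shows "shift_map M (brs a) (brs a') (glue \<pi> F)"
proof (rule shift_mapI)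
  fix x assume "x \<in> brs a"
  then show "glue \<pi> F x \<in> brs a'"
  proof (cases rule: brs_cases)
    case even
    then have "even (glue \<pi> F x n)" for n
      by (simp add: glue_even relabel_def)
    then show ?thesis by (simp add: brs_iff)
  next
    case (block d r)
    then have "glue \<pi> F x \<in> block enum a' (\<pi> d) r"
      using shift_mapD(1)[OF F] by (simp add: glue_block)
    then show ?thesis using block \<pi> brs_iff by blast
  qed
next
  fix n x y
  assume x: "x \<in> brs a" and y: "y \<in> brs a" and eq: "restr x (n + M) = restr y (n + M)"
  show "restr (glue \<pi> F x) n = restr (glue \<pi> F y) n"
  proof (cases "\<exists>i<n + M. odd (x i)")
    case True
    then obtain i where i: "i < n + M" "odd (x i)" by blast
    from x show ?thesis
    proof (cases rule: brs_cases)
      case even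
      then show ?thesis using i by blast
    next
      case (block d r)
      have "r \<le> i" using block_even[OF block(3), of i] i(2) by fastforce
      then have "y \<in> block enum a d r"
        using block_determined[OF block(3,1,2) y eq] i(1) by simp
      then show ?thesis
        using block shift_mapD(2)[OF F[OF block(1)] block(3) _ eq] by (simp add: glue_block)
    qed
  next
    case False
    have F': "F d r \<in> block enum a d r \<rightarrow> block enum a' (\<pi> d) r" if "d \<in> D" for d r
      using shift_mapD(1)[OF F[OF that]] by blast
    have "even (x i)" "even (y i)" if "i < n" for i
      using False eq that unfolding restr_eq_iff by (metis trans_less_add1)+
    then have "restr (glue \<pi> F x) n = restr (relabel \<pi> x) n" "restr (glue \<pi> F y) n = restr (relabel \<pi> y) n"
      using glue_restr_even[OF F'] x y by blast+
    moreover have "restr (relabel \<pi> x) n = restr (relabel \<pi> y) n"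
      by (rule relabel_restr) (rule restr_eq_mono[OF eq], simp)
    ultimately show ?thesis by simp
  qed
qed

text \<open>The family \<open>G\<close> is indexed by the target vertex, because
  \<open>\<pi> d\<close> is what gets decoded from \<open>F d r x\<close>; the spike level
  \<open>r\<close> is unchanged.\<close>

lemma glue_inverse:
  assumes \<pi>: "\<pi> \<in> D \<rightarrow> D" "\<And>d. d \<in> D \<Longrightarrow> \<rho> (\<pi> d) = d"
    and FG: "\<And>d r x. d \<in> D \<Longrightarrow> x \<in> block enum a d r \<Longrightarrow>
      F d r x \<in> block enum a' (\<pi> d) r \<and> G (\<pi> d) r (F d r x) = x"
    and x: "x \<in> brs a"
  shows "glue \<rho> G (glue \<pi> F x) = x"
  using x
proof (cases rule: brs_cases)
  case even
  have "\<pi> (enum (x 0 div 2)) \<in> D"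
    using \<pi>(1) by auto
  moreover have "z (enum (x 0 div 2)) 0 = x 0"
    using even[of 0] by (simp add: zbr_def)
  ultimately have "relabel \<rho> (relabel \<pi> x) = x"
    using \<pi>(2) by (simp add: relabel_def z_0)
  moreover have "even (relabel \<pi> x n)" for n
    using even by (simp add: relabel_def)
  ultimately show ?thesis using even by (simp add: glue_even)
next
  case (block d r)
  then have "\<pi> d \<in> D" "F d r x \<in> block enum a' (\<pi> d) r" "G (\<pi> d) r (F d r x) = x"
    using \<pi>(1) FG by auto
  then show ?thesis
    using block glue_block[of "F d r x" a' "\<pi> d" r] by (simp add: glue_block)
qed

text \<open>The bound \<open>M\<close> on the change of weight is uniform in the vertex and the
  spike level, so the equivalences of all blocks can be chosen with the same shift and
  glued.\<close>

lemma weighted_trees_shift_equiv: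
  assumes \<pi>: "bij_betw \<pi> D D" and M: "\<And>d. d \<in> D \<Longrightarrow> \<bar>int (a d) - int (a' (\<pi> d))\<bar> \<le> int M"
  obtains h k where "shift_equiv M (brs a) (brs a') h k" "\<And>d. d \<in> D \<Longrightarrow> h (z d) = z (\<pi> d)"
proof -
  define \<rho> where "\<rho> = inv_into D \<pi>"
  have \<rho>: "\<rho> \<in> D \<rightarrow> D" "\<And>d. d \<in> D \<Longrightarrow> \<rho> (\<pi> d) = d" "\<And>d. d \<in> D \<Longrightarrow> \<pi> (\<rho> d) = d"
    using \<pi> by (auto simp: \<rho>_def bij_betw_def inv_into_into f_inv_into_f)
  have \<pi>D: "\<pi> \<in> D \<rightarrow> D" using \<pi> by (auto simp: bij_betw_def)
  have "\<forall>d\<in>D. \<forall>r. \<exists>f g. shift_equiv M (block enum a d r) (block enum a' (\<pi> d) r) f g"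
    unfolding block_eq_fan using M by (blast intro: fan_shift_equiv)
  then obtain F G where FG: "\<And>d r. d \<in> D \<Longrightarrow>
      shift_equiv M (block enum a d r) (block enum a' (\<pi> d) r) (F d r) (G d r)"
    by metis
  \<comment> \<open>The chosen \<open>G\<close> is indexed by the source vertex, while gluing
    decodes a vertex on the target side; hence the reindexing by \<open>\<rho>\<close>.\<close>
  let ?h = "glue \<pi> F" and ?k = "glue \<rho> (\<lambda>d. G (\<rho> d))"
  have F: "shift_map M (block enum a d r) (block enum a' (\<pi> d) r) (F d r)" if "d \<in> D" for d r
    using shift_equivD(1)[OF FG[OF that]] .
  have G: "shift_map M (block enum a' d r) (block enum a (\<rho> d) r) (G (\<rho> d) r)" if "d \<in> D" for d r
    using shift_equivD(2)[OF FG, of "\<rho> d" r] \<rho>(1,3) that by auto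
  have "shift_map M (brs a) (brs a') ?h"
    using \<pi>D F by (rule glue_shift_map)
  moreover have "shift_map M (brs a') (brs a) ?k"
    using \<rho>(1) G by (rule glue_shift_map)
  moreover have "?k (?h x) = x" if "x \<in> brs a" for x
    using \<pi>D \<rho>(2) _ that
  proof (rule glue_inverse)
    fix d r x assume "d \<in> D" "x \<in> block enum a d r"
    then show "F d r x \<in> block enum a' (\<pi> d) r \<and> G (\<rho> (\<pi> d)) r (F d r x) = x"
      using shift_mapD(1)[OF F] shift_equivD(3)[OF FG] \<rho>(2) by simp
  qed
  moreover have "?h (?k y) = y" if "y \<in> brs a'" for y
    using \<rho>(1,3) _ that
  proof (rule glue_inverse)
    fix d r x assume "d \<in> D" "x \<in> block enum a' d r"
    then show "G (\<rho> d) r x \<in> block enum a (\<rho> d) r \<and> F (\<rho> d) r (G (\<rho> d) r x) = x"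
      using shift_mapD(1)[OF G] shift_equivD(4)[OF FG, of "\<rho> d" x r] \<rho>(1,3) by auto
  qed
  ultimately have "shift_equiv M (brs a) (brs a') ?h ?k"
    unfolding shift_equiv_def by blast
  moreover have "?h (z d) = z (\<pi> d)" if "d \<in> D" for d
    using that by (simp add: glue_even relabel_z)
  ultimately show ?thesis using that by blast
qed

end

section \<open>Counting nodes of blocks\<close>

context enumerated
begin

text \<open>At level \<open>L\<close> the point \<open>x\<close> of a block is encoded by the position of its spike (cut off at \<open>L\<close>),
  the height \<open>2q + 1\<close> of the spike, and the set of places where \<open>x\<close> takes the value \<open>3\<close>.\<close>

lemma card_block_nodes:
  fixes a d L
  defines "N \<equiv> (\<lambda>x. restr x L) ` (\<Union>r. block enum a d r)"
  shows "finite N" "card N \<le> 2 ^ (a d + 2 * L)"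
proof -
  define code where "code = (\<lambda>(r, q, V). map (\<lambda>j. if j < r then z d j else if j = r then 2 * q + 1
      else if j \<in> V then 3 else 1) [0..<L])"
  define S where "S = {..L} \<times> {..<2 ^ a d :: nat} \<times> Pow {..<L}"
  have "restr x L \<in> code ` S" if x: "x \<in> block enum a d r" for x r
  proof -
    obtain q where q: "restr x r = restr (z d) r" "q < 2 ^ a d" "x r = 2 * q + 1"
        "\<And>s. s > r \<Longrightarrow> x s \<in> {1, 3}"
      using x unfolding block_eq_fan fan_def by blast
    have "x j = 1" if "j > r" "x j \<noteq> 3" for j
      using q(4)[OF that(1)] that(2) by simp
    \<comment> \<open>If the spike lies at or beyond \<open>L\<close>, then
      \<open>min r L = L\<close> and every coordinate \<open>j < L\<close> falls under the stem
      case, as it should.\<close>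
    then have eq: "x j = (if j < min r L then z d j else if j = min r L then 2 * q + 1 else
        if j \<in> {j\<in>{..<L}. x j = 3} then 3 else 1)" if "j < L" for j
      using q(1,3) that by (auto simp: restr_eq_iff)
    have "restr x L = code (min r L, q, {j\<in>{..<L}. x j = 3})"
      unfolding code_def restr_def prod.case by (rule map_cong[OF refl], rule eq) simp
    moreover have "(min r L, q, {j\<in>{..<L}. x j = 3}) \<in> S"
      using q(2) by (auto simp: S_def)
    ultimately show ?thesis by blast
  qed
  then have sub: "N \<subseteq> code ` S" by (auto simp: N_def)
  have "finite S" by (simp add: S_def)
  then show "finite N" using sub finite_surj by blast
  have "card N \<le> card S"
    using sub \<open>finite S\<close> surj_card_le by blast
  also have "\<dots> = Suc L * (2 ^ a d * 2 ^ L)"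
    by (simp add: S_def card_cartesian_product card_Pow)
  \<comment> \<open>The number of spike positions is bounded crudely by \<open>2 ^ L\<close>, so
    that the exponent is the weight plus a constant independent of \<open>d\<close>.\<close>
  also have "\<dots> \<le> 2 ^ L * (2 ^ a d * 2 ^ L)"
    by (intro mult_right_mono) (simp_all add: Suc_leI)
  also have "\<dots> = 2 ^ (a d + 2 * L)"
    by (simp add: power_add mult_2)
  finally show "card N \<le> 2 ^ (a d + 2 * L)" .
qed

text \<open>The \<open>2 ^ a d\<close> admissible heights already give distinct nodes at level
  \<open>Suc r\<close>, the first level that shows the spike; the constant tail 1 completes them to
  branches.\<close>

lemma card_block_nodes_ge: "2 ^ a d \<le> card ((\<lambda>x. restr x (Suc r)) ` block enum a d r)"
proof -
  let ?x = "\<lambda>q j. if j < r then z d j else if j = r then 2 * q + 1 else 1 :: nat"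
  let ?p = "\<lambda>x. restr x (Suc r)"
  have sub: "?p ` ?x ` {..<2 ^ a d} \<subseteq> ?p ` block enum a d r"
    by (intro image_mono) (auto simp: block_eq_fan fan_def restr_eq_iff)
  \<comment> \<open>Finiteness is essential here, as \<open>card\<close> of an infinite set is
    0.\<close>
  have fin: "finite (?p ` block enum a d r)"
    by (rule finite_subset[OF _ card_block_nodes(1)[where a = a and d = d and L = "Suc r"]]) auto
  have "inj_on (\<lambda>q. ?p (?x q)) {..<2 ^ a d}"
  proof (rule inj_onI)
    fix p q assume "?p (?x p) = ?p (?x q)"
    then have "?x p r = ?x q r" unfolding restr_eq_iff by blast
    then show "p = q" by simp
  qed
  then have "card (?p ` ?x ` {..<2 ^ a d}) = 2 ^ a d"
    by (simp add: image_image card_image)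
  then show ?thesis
    using card_mono[OF fin sub] by (simp only:)
qed

text \<open>Every ball around an even branch contains branches through infinitely many nodes of a common
  level, while a block has only finitely many nodes at each level.\<close>

lemma unif_map_block_odd:
  assumes h: "unif_map (brs a) (brs a') h" and k: "unif_map (brs a') (brs a) k"
    and kh: "\<And>x. x \<in> brs a \<Longrightarrow> k (h x) = x"
    and d: "d \<in> D" "r \<ge> 2" and x: "x \<in> brs a" "h x \<in> block enum a' d r"
  shows "\<exists>n. odd (x n)"
proof (rule ccontr)
  assume "\<nexists>n. odd (x n)"
  then have even: "even (x n)" for n by blast
  \<comment> \<open>Level \<open>Suc r\<close> shows the spike of \<open>h x\<close>, so branches
    agreeing with \<open>x\<close> up to level \<open>m\<close> have images in the same
    block.\<close>
  obtain m where m: "\<And>u v. u \<in> brs a \<Longrightarrow> v \<in> brs a \<Longrightarrow> restr u m = restr v m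
      \<Longrightarrow> restr (h u) (Suc r) = restr (h v) (Suc r)"
    using unif_mapD(2)[OF h, of "Suc r"] by blast
  obtain l where l: "\<And>u v. u \<in> brs a' \<Longrightarrow> v \<in> brs a' \<Longrightarrow> restr u l = restr v l
      \<Longrightarrow> restr (k u) (Suc m) = restr (k v) (Suc m)"
    using unif_mapD(2)[OF k, of "Suc m"] by blast
  \<comment> \<open>Infinitely many even branches that agree with \<open>x\<close> before
    \<open>m\<close> and are pairwise distinguished at level \<open>Suc m\<close>; their images stay
    in the block and must differ at level \<open>l\<close>.\<close>
  define y where "y = (\<lambda>j. x(m := 2 * j :: nat))"
  have y: "y j \<in> brs a" for j
    using even by (simp add: brs_iff y_def)
  have "h (y j) \<in> block enum a' d r" for j
  proof (rule block_determined[OF x(2) d])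
    show "h (y j) \<in> brs a'" using unif_mapD(1)[OF h y] .
    show "restr (h x) (Suc r) = restr (h (y j)) (Suc r)"
      by (rule m[OF x(1) y]) (simp add: restr_eq_iff y_def)
  qed simp
  then have "range (\<lambda>j. restr (h (y j)) l) \<subseteq> (\<lambda>x. restr x l) ` (\<Union>r. block enum a' d r)"
    by blast
  then have "finite (range (\<lambda>j. restr (h (y j)) l))"
    using card_block_nodes(1) finite_subset by blast
  moreover have "inj (\<lambda>j. restr (h (y j)) l)"
  proof (rule injI)
    fix i j assume "restr (h (y i)) l = restr (h (y j)) l"
    then have "restr (k (h (y i))) (Suc m) = restr (k (h (y j))) (Suc m)"
      using unif_mapD(1)[OF h y] by (intro l)
    then have "y i m = y j m"
      using kh[OF y] by (simp add: restr_eq_iff)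
    then show "i = j" by (simp add: y_def)
  qed
  ultimately show False
    using finite_imageD infinite_UNIV_nat by blast
qed

text \<open>A block of fixed level \<open>r\<close> over \<open>\<pi> d\<close> has at least \<open>2 ^ a' (\<pi> d)\<close> nodes just above its spike; \<open>k\<close>
  maps it into the blocks over \<open>d\<close>, and the level \<open>L\<close> needed to tell these nodes apart after \<open>k\<close> does
  not depend on \<open>d\<close>.\<close>

lemma weight_bound:
  assumes h: "unif_map (brs a) (brs a') h" and k: "unif_map (brs a') (brs a) k"
    and kh: "\<And>x. x \<in> brs a \<Longrightarrow> k (h x) = x" and hk: "\<And>y. y \<in> brs a' \<Longrightarrow> h (k y) = y"
    and \<pi>: "\<pi> \<in> D \<rightarrow> D" and hz: "\<And>d. d \<in> D \<Longrightarrow> h (z d) = z (\<pi> d)"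
  shows "\<exists>M. \<forall>d\<in>D. a' (\<pi> d) \<le> a d + M"
proof -
  obtain m where m: "\<And>u v. u \<in> brs a' \<Longrightarrow> v \<in> brs a' \<Longrightarrow> restr u m = restr v m
      \<Longrightarrow> restr (k u) 1 = restr (k v) 1"
    using unif_mapD(2)[OF k, of 1] by blast
  \<comment> \<open>The bound 2 makes level \<open>r\<close> admissible for blocks. The bound
    \<open>m\<close> makes the stem, which is that of \<open>z (\<pi> d)\<close>, determine
    coordinate 0 of \<open>k y\<close>, so that \<open>k y\<close> can only lie over
    \<open>d\<close>.\<close>
  define r where "r = max 2 m"
  obtain L where L: "\<And>u v. u \<in> brs a \<Longrightarrow> v \<in> brs a \<Longrightarrow> restr u L = restr v L
      \<Longrightarrow> restr (h u) (Suc r) = restr (h v) (Suc r)"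
    using unif_mapD(2)[OF h, of "Suc r"] by blast
  have "a' (\<pi> d) \<le> a d + 2 * L" if d: "d \<in> D" for d
  proof -
    let ?B = "block enum a' (\<pi> d) r" and ?N = "(\<lambda>x. restr x L) ` (\<Union>r. block enum a d r)"
    have \<pi>d: "\<pi> d \<in> D" and "r \<ge> 2" using d \<pi> by (auto simp: r_def)
    then have B: "y \<in> brs a'" if "y \<in> ?B" for y
      using that brs_iff by blast
    have "\<exists>s. k y \<in> block enum a d s" if y: "y \<in> ?B" for y
    proof -
      have ky: "k y \<in> brs a" using unif_mapD(1)[OF k B[OF y]] .
      have "\<exists>n. odd (k y n)"
        using unif_map_block_odd[OF h k kh \<pi>d \<open>r \<ge> 2\<close> ky] hk[OF B[OF y]] y by simp
      then obtain e s where e: "e \<in> D" "s \<ge> 2" "k y \<in> block enum a e s"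
        using ky unfolding brs_iff by blast
      have "restr y r = restr (z (\<pi> d)) r"
        using y by (simp add: block_eq_fan fan_def)
      then have "restr y m = restr (z (\<pi> d)) m"
        by (rule restr_eq_mono) (simp add: r_def)
      then have "restr (k y) 1 = restr (k (z (\<pi> d))) 1"
        using B[OF y] by (intro m) simp_all
      also have "k (z (\<pi> d)) = z d"
        using kh[OF z_in_brs, of d] hz[OF d] by simp
      finally have "k y 0 = z d 0"
        by (simp add: restr_eq_iff)
      then have "e = d"
        using block_0[OF e(3,1)] e(2) z_0[OF d] by simp
      then show ?thesis using e by blast
    qed
    then have sub: "(\<lambda>y. restr (k y) L) ` ?B \<subseteq> ?N"
      by blast
    \<comment> \<open>Recovers the node of \<open>y\<close> at level \<open>Suc r\<close> from the
      node of \<open>k y\<close> at level \<open>L\<close>: any branch through the latter may be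
      taken, since its image under \<open>h\<close> has the same first \<open>Suc r\<close>
      coordinates.\<close>
    let ?t = "\<lambda>s. restr (h (SOME x. x \<in> brs a \<and> restr x L = s)) (Suc r)"
    have "?t (restr (k y) L) = restr y (Suc r)" if y: "y \<in> ?B" for y
    proof -
      let ?x = "SOME x. x \<in> brs a \<and> restr x L = restr (k y) L"
      have ky: "k y \<in> brs a" using unif_mapD(1)[OF k B[OF y]] .
      then have "?x \<in> brs a \<and> restr ?x L = restr (k y) L"
        by (intro someI[of "\<lambda>x. x \<in> brs a \<and> restr x L = restr (k y) L" "k y"]) simp
      then have "?t (restr (k y) L) = restr (h (k y)) (Suc r)"
        using ky by (intro L) simp_all
      then show ?thesis using hk[OF B[OF y]] by simp
    qed
    then have "(\<lambda>y. restr y (Suc r)) ` ?B \<subseteq> ?t ` (\<lambda>y. restr (k y) L) ` ?B"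
      by (force simp: image_image)
    also have "\<dots> \<subseteq> ?t ` ?N"
      using sub by (rule image_mono)
    finally have "card ((\<lambda>y. restr y (Suc r)) ` ?B) \<le> card ?N"
      using card_block_nodes(1) surj_card_le by blast
    then have "2 ^ a' (\<pi> d) \<le> (2::nat) ^ (a d + 2 * L)"
      using card_block_nodes_ge[of a' "\<pi> d" r] card_block_nodes(2)[of L a d] by linarith
    then show ?thesis by simp
  qed
  then show ?thesis by blast
qed

text \<open>The one-sided bound is applied to \<open>h\<close> with \<open>\<pi>\<close> and to
  \<open>k\<close> with the inverse of \<open>\<pi>\<close>; the sum of the two constants bounds the
  absolute value.\<close>

lemma weight_difference_bound:
  assumes h: "unif_map (brs a) (brs a') h" and k: "unif_map (brs a') (brs a) k"
    and kh: "\<And>x. x \<in> brs a \<Longrightarrow> k (h x) = x" and hk: "\<And>y. y \<in> brs a' \<Longrightarrow> h (k y) = y"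
    and \<pi>: "bij_betw \<pi> D D" and hz: "\<And>d. d \<in> D \<Longrightarrow> h (z d) = z (\<pi> d)"
  shows "\<exists>M::nat. \<forall>d\<in>D. \<bar>int (a d) - int (a' (\<pi> d))\<bar> \<le> int M"
proof -
  define \<rho> where "\<rho> = inv_into D \<pi>"
  have \<rho>: "\<rho> \<in> D \<rightarrow> D" "\<And>d. d \<in> D \<Longrightarrow> \<rho> (\<pi> d) = d" "\<And>d. d \<in> D \<Longrightarrow> \<pi> (\<rho> d) = d"
    using \<pi> by (auto simp: \<rho>_def bij_betw_def inv_into_into f_inv_into_f)
  have \<pi>D: "\<pi> \<in> D \<rightarrow> D" using \<pi> by (auto simp: bij_betw_def)
  have kz: "k (z d) = z (\<rho> d)" if "d \<in> D" for d
    using kh[OF z_in_brs, of "\<rho> d"] hz[of "\<rho> d"] \<rho>(1,3) that funcset_mem by fastforce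
  obtain M where M: "\<And>d. d \<in> D \<Longrightarrow> a' (\<pi> d) \<le> a d + M"
    using weight_bound[OF h k kh hk \<pi>D hz] by blast
  obtain M' where M': "\<And>d. d \<in> D \<Longrightarrow> a (\<rho> d) \<le> a' d + M'"
    using weight_bound[OF k h hk kh \<rho>(1) kz] by blast
  have "\<bar>int (a d) - int (a' (\<pi> d))\<bar> \<le> int (M + M')" if "d \<in> D" for d
    using M[OF that] M'[of "\<pi> d"] \<rho>(2)[OF that] \<pi>D that by fastforce
  then show ?thesis by blast
qed

end

section \<open>Isomorphism of inverse systems\<close>

locale categ =
  fixes K :: "('o, 'm) category"
  assumes is_category: "is_category K"
begin

abbreviation "ob \<equiv> Obj K"
abbreviation "hm \<equiv> Hom K"
abbreviation "cp \<equiv> Comp K"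

lemma ident: "x \<in> ob \<Longrightarrow> Ident K x \<in> hm x x"
  and comp: "x \<in> ob \<Longrightarrow> y \<in> ob \<Longrightarrow> w \<in> ob \<Longrightarrow> f \<in> hm x y \<Longrightarrow> g \<in> hm y w \<Longrightarrow> cp x y w g f \<in> hm x w"
  and comp_ident: "x \<in> ob \<Longrightarrow> y \<in> ob \<Longrightarrow> f \<in> hm x y \<Longrightarrow> cp x x y f (Ident K x) = f"
  and ident_comp: "x \<in> ob \<Longrightarrow> y \<in> ob \<Longrightarrow> f \<in> hm x y \<Longrightarrow> cp x y y (Ident K y) f = f"
  using is_category unfolding is_category_def by blast+

lemma assoc: "v \<in> ob \<Longrightarrow> x \<in> ob \<Longrightarrow> y \<in> ob \<Longrightarrow> w \<in> ob \<Longrightarrow> f \<in> hm v x \<Longrightarrow> g \<in> hm x y \<Longrightarrow> h \<in> hm y w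
    \<Longrightarrow> cp v x w (cp x y w h g) f = cp v y w h (cp v x y g f)"
  using is_category unfolding is_category_def by blast

lemma inverse_systemD:
  assumes "X \<in> inverse_systems K"
  shows "n \<ge> 1 \<Longrightarrow> stage X n \<in> ob"
    and "n \<ge> 1 \<Longrightarrow> m \<ge> n \<Longrightarrow> bond X m n \<in> hm (stage X m) (stage X n)"
    and "n \<ge> 1 \<Longrightarrow> bond X n n = Ident K (stage X n)"
    and "n \<ge> 1 \<Longrightarrow> m \<ge> n \<Longrightarrow> l \<ge> m \<Longrightarrow>
      cp (stage X l) (stage X m) (stage X n) (bond X m n) (bond X l m) = bond X l n"
  using assms unfolding inverse_systems_def by blast+

section \<open>Pre-morphisms, their equivalence and their composition\<close>

lemma premorphism_index:
  assumes "(\<phi>, f) \<in> premorphisms K X Y"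
  shows "\<phi> \<in> {1..} \<rightarrow> {1..}" "strict_mono_on {1..} \<phi>"
  using conjunct1[OF assms[unfolded premorphisms_def mem_Collect_eq prod.case]]
    conjunct1[OF conjunct2[OF assms[unfolded premorphisms_def mem_Collect_eq prod.case]]] .

lemma premorphismD:
  assumes "(\<phi>, f) \<in> premorphisms K X Y"
  shows "n \<ge> 1 \<Longrightarrow> \<phi> n \<ge> 1"
    and "n \<ge> 1 \<Longrightarrow> m \<ge> n \<Longrightarrow> \<phi> n \<le> \<phi> m"
    and "n \<ge> 1 \<Longrightarrow> f n \<in> hm (stage X (\<phi> n)) (stage Y n)"
    and "n \<ge> 1 \<Longrightarrow> m \<ge> n \<Longrightarrow> cp (stage X (\<phi> m)) (stage Y m) (stage Y n) (bond Y m n) (f m) =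
           cp (stage X (\<phi> m)) (stage X (\<phi> n)) (stage Y n) (f n) (bond X (\<phi> m) (\<phi> n))"
proof -
  show "n \<ge> 1 \<Longrightarrow> \<phi> n \<ge> 1" using premorphism_index(1)[OF assms] by auto
  show "n \<ge> 1 \<Longrightarrow> m \<ge> n \<Longrightarrow> \<phi> n \<le> \<phi> m"
    using premorphism_index(2)[OF assms] by (simp add: strict_mono_on_leD)
qed (use assms in \<open>unfold premorphisms_def, blast+\<close>)

text \<open>A bonding map factors through any intermediate stage; thus an equality of composites at
  stage \<open>r\<close> persists at every later stage.\<close>

lemma stage_comp_bond:
  assumes X: "X \<in> inverse_systems K" and "y \<in> ob" "p \<ge> 1" "r \<ge> p" "s \<ge> r" "f \<in> hm (stage X p) y"
  shows "cp (stage X s) (stage X p) y f (bond X s p) =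
    cp (stage X s) (stage X r) y (cp (stage X r) (stage X p) y f (bond X r p)) (bond X s r)"
  using assms assoc[of "stage X s" "stage X r" "stage X p" y "bond X s r" "bond X r p" f]
  by (simp add: inverse_systemD[OF X])

lemma premor_relI:
  assumes "(\<phi>, f) \<in> premorphisms K X Y" "(\<phi>', f') \<in> premorphisms K X Y"
    and "\<And>n. n \<ge> 1 \<Longrightarrow> \<exists>r. r \<ge> \<phi> n \<and> r \<ge> \<phi>' n \<and>
       cp (stage X r) (stage X (\<phi> n)) (stage Y n) (f n) (bond X r (\<phi> n)) =
       cp (stage X r) (stage X (\<phi>' n)) (stage Y n) (f' n) (bond X r (\<phi>' n))"
  shows "((\<phi>, f), (\<phi>', f')) \<in> premor_rel K X Y"
  using assms unfolding premor_rel_def by blast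

lemma premor_relD:
  assumes "((\<phi>, f), (\<phi>', f')) \<in> premor_rel K X Y"
  shows "(\<phi>, f) \<in> premorphisms K X Y" "(\<phi>', f') \<in> premorphisms K X Y"
    and "n \<ge> 1 \<Longrightarrow> \<exists>r. r \<ge> \<phi> n \<and> r \<ge> \<phi>' n \<and>
       cp (stage X r) (stage X (\<phi> n)) (stage Y n) (f n) (bond X r (\<phi> n)) =
       cp (stage X r) (stage X (\<phi>' n)) (stage Y n) (f' n) (bond X r (\<phi>' n))"
  using assms unfolding premor_rel_def by blast+

lemma equiv_premor_rel:
  assumes X: "X \<in> inverse_systems K" and Y: "Y \<in> inverse_systems K"
  shows "equiv (premorphisms K X Y) (premor_rel K X Y)"
proof (rule equivI)
  show "premor_rel K X Y \<subseteq> premorphisms K X Y \<times> premorphisms K X Y"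
    unfolding premor_rel_def by blast
  show "refl_on (premorphisms K X Y) (premor_rel K X Y)"
  proof (rule refl_onI)
    fix p assume "p \<in> premorphisms K X Y"
    then show "(p, p) \<in> premor_rel K X Y"
      by (cases p) (blast intro: premor_relI)
  qed
  show "sym (premor_rel K X Y)"
  proof (rule symI)
    fix p q assume "(p, q) \<in> premor_rel K X Y"
    then show "(q, p) \<in> premor_rel K X Y"
      unfolding premor_rel_def by (cases p; cases q) (simp, metis)
  qed
  show "trans (premor_rel K X Y)"
  proof (rule transI)
    fix p q s assume pq: "(p, q) \<in> premor_rel K X Y" and qs: "(q, s) \<in> premor_rel K X Y"
    obtain \<phi> f where p: "p = (\<phi>, f)" by force
    obtain \<psi> g where q: "q = (\<psi>, g)" by force
    obtain \<theta> h where s: "s = (\<theta>, h)" by force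
    note pq = premor_relD[OF pq[unfolded p q]] and qs = premor_relD[OF qs[unfolded q s]]
    show "(p, s) \<in> premor_rel K X Y"
      unfolding p s
    proof (rule premor_relI[OF pq(1) qs(2)])
      fix n :: nat assume n: "n \<ge> 1"
      obtain r where r: "r \<ge> \<phi> n" "r \<ge> \<psi> n"
        "cp (stage X r) (stage X (\<phi> n)) (stage Y n) (f n) (bond X r (\<phi> n)) =
         cp (stage X r) (stage X (\<psi> n)) (stage Y n) (g n) (bond X r (\<psi> n))"
        using pq(3)[OF n] by blast
      obtain t where t: "t \<ge> \<psi> n" "t \<ge> \<theta> n"
        "cp (stage X t) (stage X (\<psi> n)) (stage Y n) (g n) (bond X t (\<psi> n)) =
         cp (stage X t) (stage X (\<theta> n)) (stage Y n) (h n) (bond X t (\<theta> n))"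
        using qs(3)[OF n] by blast
      \<comment> \<open>For transitivity, the equalities known at stages \<open>r\<close> and
        \<open>t\<close> are both moved to stage \<open>max r t\<close>, where they can be
        chained.\<close>
      have later: "cp (stage X (max r t)) (stage X (\<phi>' n)) (stage Y n) (f' n) (bond X (max r t) (\<phi>' n)) =
         cp (stage X (max r t)) (stage X u) (stage Y n)
           (cp (stage X u) (stage X (\<phi>' n)) (stage Y n) (f' n) (bond X u (\<phi>' n))) (bond X (max r t) u)"
        if "(\<phi>', f') \<in> premorphisms K X Y" "u \<ge> \<phi>' n" "max r t \<ge> u" for \<phi>' f' u
        using that n premorphismD[OF that(1)] inverse_systemD(1)[OF Y] by (intro stage_comp_bond[OF X]) auto
      have "cp (stage X (max r t)) (stage X (\<phi> n)) (stage Y n) (f n) (bond X (max r t) (\<phi> n)) =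
            cp (stage X (max r t)) (stage X (\<psi> n)) (stage Y n) (g n) (bond X (max r t) (\<psi> n))"
        using later[OF pq(1) r(1)] later[OF pq(2) r(2)] r(3) by simp
      also have "\<dots> = cp (stage X (max r t)) (stage X (\<theta> n)) (stage Y n) (h n) (bond X (max r t) (\<theta> n))"
        using later[OF qs(1) t(1)] later[OF qs(2) t(2)] t(3) by simp
      finally show "\<exists>r. r \<ge> \<phi> n \<and> r \<ge> \<theta> n \<and>
         cp (stage X r) (stage X (\<phi> n)) (stage Y n) (f n) (bond X r (\<phi> n)) =
         cp (stage X r) (stage X (\<theta> n)) (stage Y n) (h n) (bond X r (\<theta> n))"
        using r t by (intro exI[of _ "max r t"]) auto
    qed
  qed
qed

text \<open>The compatibility square of the composite is obtained by pasting the square of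
  \<open>g\<close> at \<open>m \<ge> n\<close> with that of \<open>f\<close> at
  \<open>\<psi> m \<ge> \<psi> n\<close>.\<close>

lemma premor_comp_pair:
  assumes X: "X \<in> inverse_systems K" and Y: "Y \<in> inverse_systems K" and Z: "Z \<in> inverse_systems K"
    and f: "(\<phi>, f) \<in> premorphisms K X Y" and g: "(\<psi>, g) \<in> premorphisms K Y Z"
  shows "premor_comp K X Y Z (\<psi>, g) (\<phi>, f) \<in> premorphisms K X Z"
proof -
  note f' = premorphismD[OF f] and g' = premorphismD[OF g]
  note oX = inverse_systemD(1)[OF X] and oY = inverse_systemD(1)[OF Y] and oZ = inverse_systemD(1)[OF Z]
  let ?c = "\<lambda>n. cp (stage X (\<phi> (\<psi> n))) (stage Y (\<psi> n)) (stage Z n) (g n) (f (\<psi> n))"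
  have "strict_mono_on {1..} (\<phi> \<circ> \<psi>)" "\<phi> \<circ> \<psi> \<in> {1..} \<rightarrow> {1..}"
    using premorphism_index[OF f] premorphism_index[OF g] by (auto simp: strict_mono_on_def Pi_iff)
  moreover have "?c n \<in> hm (stage X ((\<phi> \<circ> \<psi>) n)) (stage Z n)" if n: "n \<ge> 1" for n
    using n f' g' oX oY oZ by (simp add: comp)
  moreover have "cp (stage X ((\<phi> \<circ> \<psi>) m)) (stage Z m) (stage Z n) (bond Z m n) (?c m) =
     cp (stage X ((\<phi> \<circ> \<psi>) m)) (stage X ((\<phi> \<circ> \<psi>) n)) (stage Z n) (?c n) (bond X ((\<phi> \<circ> \<psi>) m) ((\<phi> \<circ> \<psi>) n))"
    if n: "n \<ge> 1" "m \<ge> n" for m n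
  proof -
    have m: "m \<ge> 1" using n by simp
    let ?a = "stage X (\<phi> (\<psi> m))" and ?b = "stage X (\<phi> (\<psi> n))"
      and ?u = "stage Y (\<psi> m)" and ?v = "stage Y (\<psi> n)" and ?s = "stage Z m" and ?t = "stage Z n"
    let ?x = "bond X (\<phi> (\<psi> m)) (\<phi> (\<psi> n))" and ?y = "bond Y (\<psi> m) (\<psi> n)" and ?z = "bond Z m n"
    have o: "?a \<in> ob" "?b \<in> ob" "?u \<in> ob" "?v \<in> ob" "?s \<in> ob" "?t \<in> ob"
      using n m f' g' oX oY oZ by simp_all
    have a: "f (\<psi> m) \<in> hm ?a ?u" "f (\<psi> n) \<in> hm ?b ?v" "g m \<in> hm ?u ?s" "g n \<in> hm ?v ?t"
      "?x \<in> hm ?a ?b" "?y \<in> hm ?u ?v" "?z \<in> hm ?s ?t"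
      using n m f' g' inverse_systemD(2)[OF X] inverse_systemD(2)[OF Y] inverse_systemD(2)[OF Z] by simp_all
    have "cp ?a ?s ?t ?z (cp ?a ?u ?s (g m) (f (\<psi> m))) = cp ?a ?u ?t (cp ?u ?s ?t ?z (g m)) (f (\<psi> m))"
      using o a by (simp add: assoc)
    also have "cp ?u ?s ?t ?z (g m) = cp ?u ?v ?t (g n) ?y"
      using g'(4) n by blast
    also have "cp ?a ?u ?t (cp ?u ?v ?t (g n) ?y) (f (\<psi> m)) = cp ?a ?v ?t (g n) (cp ?a ?u ?v ?y (f (\<psi> m)))"
      using o a by (simp add: assoc)
    also have "cp ?a ?u ?v ?y (f (\<psi> m)) = cp ?a ?b ?v (f (\<psi> n)) ?x"
      using f'(4)[of "\<psi> n" "\<psi> m"] g'(1,2) n by blast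
    also have "cp ?a ?v ?t (g n) (cp ?a ?b ?v (f (\<psi> n)) ?x) = cp ?a ?b ?t (cp ?b ?v ?t (g n) (f (\<psi> n))) ?x"
      using o a by (simp add: assoc)
    finally show ?thesis by simp
  qed
  ultimately show ?thesis
    unfolding premorphisms_def premor_comp.simps by blast
qed

lemma premor_comp_premorphism:
  assumes "X \<in> inverse_systems K" "Y \<in> inverse_systems K" "Z \<in> inverse_systems K"
    and "p \<in> premorphisms K X Y" "q \<in> premorphisms K Y Z"
  shows "premor_comp K X Y Z q p \<in> premorphisms K X Z"
  using assms premor_comp_pair by (cases p; cases q) blast

text \<open>Let \<open>r\<close> witness the equivalence of \<open>g\<close> and \<open>g'\<close>
  at \<open>n\<close>, and let \<open>s\<close> witness that of \<open>f\<close> and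
  \<open>f'\<close> at \<open>r\<close>. At stage \<open>s\<close> both composites factor through
  stage \<open>r\<close> of \<open>Y\<close>, and the factors agree.\<close>

lemma premor_comp_cong:
  assumes X: "X \<in> inverse_systems K" and Y: "Y \<in> inverse_systems K" and Z: "Z \<in> inverse_systems K"
    and f: "((\<phi>, f), (\<phi>', f')) \<in> premor_rel K X Y" and g: "((\<psi>, g), (\<psi>', g')) \<in> premor_rel K Y Z"
  shows "(premor_comp K X Y Z (\<psi>, g) (\<phi>, f), premor_comp K X Y Z (\<psi>', g') (\<phi>', f')) \<in> premor_rel K X Z"
proof -
  note fr = premor_relD[OF f] and gr = premor_relD[OF g]
  note oX = inverse_systemD(1)[OF X] and oY = inverse_systemD(1)[OF Y] and oZ = inverse_systemD(1)[OF Z]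
  \<comment> \<open>Rewrites a composite at stage \<open>s\<close> so that its two factors are
    exactly the maps compared by the two equivalences.\<close>
  have push: "cp (stage X s) (stage X (\<phi> (\<psi> n))) (stage Z n)
        (cp (stage X (\<phi> (\<psi> n))) (stage Y (\<psi> n)) (stage Z n) (g n) (f (\<psi> n))) (bond X s (\<phi> (\<psi> n))) =
      cp (stage X s) (stage Y r) (stage Z n) (cp (stage Y r) (stage Y (\<psi> n)) (stage Z n) (g n) (bond Y r (\<psi> n)))
        (cp (stage X s) (stage X (\<phi> r)) (stage Y r) (f r) (bond X s (\<phi> r)))"
    if f: "(\<phi>, f) \<in> premorphisms K X Y" and g: "(\<psi>, g) \<in> premorphisms K Y Z"
      and n: "n \<ge> 1" and r: "r \<ge> \<psi> n" and s: "s \<ge> \<phi> r" for \<phi> \<psi> f g n r s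
  proof -
    note f' = premorphismD[OF f] and g' = premorphismD[OF g]
    let ?a = "stage X s" and ?b = "stage X (\<phi> r)" and ?c = "stage X (\<phi> (\<psi> n))"
      and ?u = "stage Y r" and ?v = "stage Y (\<psi> n)" and ?t = "stage Z n"
    let ?x = "bond X s (\<phi> r)" and ?x' = "bond X (\<phi> r) (\<phi> (\<psi> n))" and ?y = "bond Y r (\<psi> n)"
    have p: "\<psi> n \<ge> 1" "\<phi> (\<psi> n) \<ge> 1" "r \<ge> 1" "\<phi> r \<ge> \<phi> (\<psi> n)" "\<phi> r \<ge> 1" "s \<ge> 1"
      using g'(1)[OF n] f'(1)[of "\<psi> n"] f'(1)[of r] f'(2)[of "\<psi> n" r] r s by auto
    have o: "?a \<in> ob" "?b \<in> ob" "?c \<in> ob" "?u \<in> ob" "?v \<in> ob" "?t \<in> ob"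
      using p n oX oY oZ by blast+
    have m: "f r \<in> hm ?b ?u" "f (\<psi> n) \<in> hm ?c ?v" "g n \<in> hm ?v ?t" "?x \<in> hm ?a ?b" "?x' \<in> hm ?b ?c" "?y \<in> hm ?u ?v"
      using p n r s f'(3) g'(3) inverse_systemD(2)[OF X] inverse_systemD(2)[OF Y] by blast+
    have x: "bond X s (\<phi> (\<psi> n)) = cp ?a ?b ?c ?x' ?x"
      using inverse_systemD(4)[OF X p(2,4) s] by simp
    have y: "cp ?b ?c ?v (f (\<psi> n)) ?x' = cp ?b ?u ?v ?y (f r)"
      using f'(4)[OF p(1) r] by simp
    have "cp ?a ?c ?t (cp ?c ?v ?t (g n) (f (\<psi> n))) (cp ?a ?b ?c ?x' ?x) =
      cp ?a ?v ?t (g n) (cp ?a ?b ?v (cp ?b ?c ?v (f (\<psi> n)) ?x') ?x)"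
      using o m by (simp add: assoc comp)
    also have "\<dots> = cp ?a ?v ?t (g n) (cp ?a ?u ?v ?y (cp ?a ?b ?u (f r) ?x))"
      unfolding y using o m by (simp add: assoc)
    also have "\<dots> = cp ?a ?u ?t (cp ?u ?v ?t (g n) ?y) (cp ?a ?b ?u (f r) ?x)"
      using o m by (simp add: assoc comp)
    finally show ?thesis unfolding x .
  qed
  show ?thesis
    unfolding premor_comp.simps
  proof (rule premor_relI)
    show "(\<phi> \<circ> \<psi>, \<lambda>n. cp (stage X (\<phi> (\<psi> n))) (stage Y (\<psi> n)) (stage Z n) (g n) (f (\<psi> n))) \<in> premorphisms K X Z"
      "(\<phi>' \<circ> \<psi>', \<lambda>n. cp (stage X (\<phi>' (\<psi>' n))) (stage Y (\<psi>' n)) (stage Z n) (g' n) (f' (\<psi>' n))) \<in> premorphisms K X Z"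
      using premor_comp_pair[OF X Y Z fr(1) gr(1)] premor_comp_pair[OF X Y Z fr(2) gr(2)] by simp_all
    fix n :: nat assume n: "n \<ge> 1"
    obtain r where r: "r \<ge> \<psi> n" "r \<ge> \<psi>' n"
      "cp (stage Y r) (stage Y (\<psi> n)) (stage Z n) (g n) (bond Y r (\<psi> n)) =
       cp (stage Y r) (stage Y (\<psi>' n)) (stage Z n) (g' n) (bond Y r (\<psi>' n))"
      using gr(3)[OF n] by blast
    have "r \<ge> 1" using premorphismD(1)[OF gr(1) n] r by simp
    then obtain s where s: "s \<ge> \<phi> r" "s \<ge> \<phi>' r"
      "cp (stage X s) (stage X (\<phi> r)) (stage Y r) (f r) (bond X s (\<phi> r)) =
       cp (stage X s) (stage X (\<phi>' r)) (stage Y r) (f' r) (bond X s (\<phi>' r))"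
      using fr(3) by blast
    have "s \<ge> \<phi> (\<psi> n)" "s \<ge> \<phi>' (\<psi>' n)"
      using premorphismD(2)[OF fr(1) premorphismD(1)[OF gr(1) n] r(1)] s(1)
        premorphismD(2)[OF fr(2) premorphismD(1)[OF gr(2) n] r(2)] s(2) by simp_all
    then show "\<exists>s. s \<ge> (\<phi> \<circ> \<psi>) n \<and> s \<ge> (\<phi>' \<circ> \<psi>') n \<and>
        cp (stage X s) (stage X ((\<phi> \<circ> \<psi>) n)) (stage Z n)
          (cp (stage X (\<phi> (\<psi> n))) (stage Y (\<psi> n)) (stage Z n) (g n) (f (\<psi> n))) (bond X s ((\<phi> \<circ> \<psi>) n)) =
        cp (stage X s) (stage X ((\<phi>' \<circ> \<psi>') n)) (stage Z n)
          (cp (stage X (\<phi>' (\<psi>' n))) (stage Y (\<psi>' n)) (stage Z n) (g' n) (f' (\<psi>' n))) (bond X s ((\<phi>' \<circ> \<psi>') n))"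
      using push[OF fr(1) gr(1) n r(1) s(1)] push[OF fr(2) gr(2) n r(2) s(2)] r(3) s(3)
      by (intro exI[of _ s]) simp
  qed
qed

text \<open>By congruence all representatives give the same class, so the union defining composition
  in \<open>Pro\<close> collapses. The classes must be nonempty, as an empty union would be
  empty.\<close>

lemma Pro_comp_classes:
  assumes X: "X \<in> inverse_systems K" and Y: "Y \<in> inverse_systems K" and Z: "Z \<in> inverse_systems K"
    and p: "p \<in> premorphisms K X Y" and q: "q \<in> premorphisms K Y Z"
  shows "Comp (Pro K) X Y Z (premor_rel K Y Z `` {q}) (premor_rel K X Y `` {p}) =
    premor_rel K X Z `` {premor_comp K X Y Z q p}"
proof -
  have eq: "premor_rel K X Z `` {premor_comp K X Y Z q' p'} = premor_rel K X Z `` {premor_comp K X Y Z q p}"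
    if "(q, q') \<in> premor_rel K Y Z" "(p, p') \<in> premor_rel K X Y" for p' q'
  proof -
    obtain \<phi> f \<phi>' f' \<psi> g \<psi>' g' where "p = (\<phi>, f)" "p' = (\<phi>', f')" "q = (\<psi>, g)" "q' = (\<psi>', g')"
      by (cases p; cases p'; cases q; cases q') blast
    then show ?thesis
      using premor_comp_cong[OF X Y Z, of \<phi> f \<phi>' f' \<psi> g \<psi>' g'] that
        equiv_class_eq[OF equiv_premor_rel[OF X Z]] by simp
  qed
  have "q \<in> premor_rel K Y Z `` {q}" "p \<in> premor_rel K X Y `` {p}"
    using equiv_class_self[OF equiv_premor_rel[OF Y Z] q] equiv_class_self[OF equiv_premor_rel[OF X Y] p] .
  then have ne: "premor_rel K Y Z `` {q} \<noteq> {}" "premor_rel K X Y `` {p} \<noteq> {}"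
    by blast+
  have "Comp (Pro K) X Y Z (premor_rel K Y Z `` {q}) (premor_rel K X Y `` {p}) =
    (\<Union>q'\<in>premor_rel K Y Z `` {q}. \<Union>p'\<in>premor_rel K X Y `` {p}. premor_rel K X Z `` {premor_comp K X Y Z q p})"
    unfolding Pro_def category.simps by (intro SUP_cong refl eq) simp_all
  then show ?thesis
    using ne by simp
qed

lemma premor_ident_premorphism:
  assumes X: "X \<in> inverse_systems K"
  shows "premor_ident K X \<in> premorphisms K X X"
  using inverse_systemD[OF X]
  by (auto simp: premor_ident_def premorphisms_def strict_mono_on_def ident comp_ident ident_comp)

text \<open>Morphisms are classes, so representatives may be chosen; two classes coincide exactly
  when their representatives are related.\<close>

lemma isomorphic_in_Pro_iff:
  assumes X: "X \<in> inverse_systems K" and Y: "Y \<in> inverse_systems K"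
  shows "isomorphic_in (Pro K) X Y \<longleftrightarrow>
    (\<exists>p\<in>premorphisms K X Y. \<exists>q\<in>premorphisms K Y X.
      (premor_comp K X Y X q p, premor_ident K X) \<in> premor_rel K X X \<and>
      (premor_comp K Y X Y p q, premor_ident K Y) \<in> premor_rel K Y Y)"
proof -
  have eq: "premor_rel K X X `` {premor_comp K X Y X q p} = premor_rel K X X `` {premor_ident K X}
      \<longleftrightarrow> (premor_comp K X Y X q p, premor_ident K X) \<in> premor_rel K X X"
    if "X \<in> inverse_systems K" "Y \<in> inverse_systems K" "p \<in> premorphisms K X Y" "q \<in> premorphisms K Y X" for X Y p q
    using eq_equiv_class_iff[OF equiv_premor_rel[OF that(1,1)]] premor_comp_premorphism[OF that(1,2,1,3,4)]
      premor_ident_premorphism[OF that(1)] by simp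
  have "isomorphic_in (Pro K) X Y \<longleftrightarrow>
    (\<exists>p\<in>premorphisms K X Y. \<exists>q\<in>premorphisms K Y X.
       Comp (Pro K) X Y X (premor_rel K Y X `` {q}) (premor_rel K X Y `` {p}) = Ident (Pro K) X \<and>
       Comp (Pro K) Y X Y (premor_rel K X Y `` {p}) (premor_rel K Y X `` {q}) = Ident (Pro K) Y)"
    unfolding isomorphic_in_def using X Y by (simp add: Pro_def quotient_def)
  also have "\<dots> \<longleftrightarrow> (\<exists>p\<in>premorphisms K X Y. \<exists>q\<in>premorphisms K Y X.
      (premor_comp K X Y X q p, premor_ident K X) \<in> premor_rel K X X \<and>
      (premor_comp K Y X Y p q, premor_ident K Y) \<in> premor_rel K Y Y)"
    using eq[OF X Y] eq[OF Y X] Pro_comp_classes[OF X Y X] Pro_comp_classes[OF Y X Y]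
    by (simp add: Pro_def cong: bex_cong)
  finally show ?thesis .
qed

end

section \<open>The systems of weighted trees\<close>

interpretation mGraph: categ "mGraphEpi :: (('v, 'e) pre_digraph, ('v \<Rightarrow> 'v) \<times> ('e \<Rightarrow> 'e)) category"
  by unfold_locales (rule is_category_mGraphEpi)

lemma Hom_mGraphEpi_iff:
  "p \<in> Hom mGraphEpi G H \<longleftrightarrow>
     fst p \<in> verts G \<rightarrow>\<^sub>E verts H \<and> snd p \<in> arcs G \<rightarrow>\<^sub>E arcs H \<and>
     (\<forall>e\<in>arcs G. tail H (snd p e) = fst p (tail G e) \<and> head H (snd p e) = fst p (head G e)) \<and>
     fst p ` verts G = verts H \<and> snd p ` arcs G = arcs H"
  by (cases p) (simp add: mGraphEpi_def)

lemma Comp_mGraphEpi: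
  "Comp mGraphEpi G H J g f = (compose (verts G) (fst g) (fst f), compose (arcs G) (snd g) (snd f))"
  by (cases g; cases f) (simp add: mGraphEpi_def)

locale weighted_trees = enumerated D enum for D :: "'d set" and enum :: "nat \<Rightarrow> 'd" +
  fixes E :: "'d rel"
  assumes irrefl: "irrefl_on D E"
begin

abbreviation graph :: "('d \<Rightarrow> nat) \<Rightarrow> nat \<Rightarrow> (nat list, 'd label) pre_digraph" where
  "graph a n \<equiv> Gamma_graph D E enum a n"

abbreviation "sys a \<equiv> Gamma_sys D E enum a"

definition labels :: "'d label set" where
  "labels = {Loop d | d. d \<in> D} \<union> {Arc d e | d e. d \<in> D \<and> e \<in> D \<and> d \<noteq> e \<and> (d, e) \<in> E}"

lemma arcs_graph [simp]: "arcs (graph a n) = labels"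
  by (simp add: Gamma_graph_def labels_def)

text \<open>As the tree has no dead ends, every vertex is a node of a branch; vertex maps can thus
  be described and compared along branches.\<close>

lemma verts_graph: "verts (graph a n) = (\<lambda>x. restr x n) ` brs a"
  unfolding Gamma_graph_def using wtree_extend[of _ a] branches_restr by fastforce

lemma graph_ends [simp]:
  "tail (graph a n) l = restr (z (label_src l)) n" "head (graph a n) l = restr (z (label_tgt l)) n"
  by (simp_all add: Gamma_graph_def)

lemma stage_sys [simp]: "stage (sys a) n = graph a n"
  by (simp add: Gamma_sys_def)

lemma bond_sys:
  "x \<in> brs a \<Longrightarrow> n \<le> m \<Longrightarrow> fst (bond (sys a) m n) (restr x m) = restr x n"
  "l \<in> labels \<Longrightarrow> snd (bond (sys a) m n) l = l"
  by (auto simp: Gamma_sys_def verts_graph take_restr)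

lemma Ident_graph:
  "x \<in> brs a \<Longrightarrow> fst (Ident mGraphEpi (graph a n)) (restr x n) = restr x n"
  "l \<in> labels \<Longrightarrow> snd (Ident mGraphEpi (graph a n)) l = l"
  by (auto simp: mGraphEpi_def verts_graph)

lemma Comp_graph:
  "x \<in> brs a \<Longrightarrow> fst (Comp mGraphEpi (graph a n) H J g f) (restr x n) = fst g (fst f (restr x n))"
  "l \<in> labels \<Longrightarrow> snd (Comp mGraphEpi (graph a n) H J g f) l = snd g (snd f l)"
  by (auto simp: Comp_mGraphEpi compose_def verts_graph)

lemma Comp_graph_eqI:
  assumes "\<And>x. x \<in> brs a \<Longrightarrow> fst g (fst f (restr x n)) = fst g' (fst f' (restr x n))"
    and "\<And>l. l \<in> labels \<Longrightarrow> snd g (snd f l) = snd g' (snd f' l)"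
  shows "Comp mGraphEpi (graph a n) H J g f = Comp mGraphEpi (graph a n) H' J' g' f'"
  unfolding Comp_mGraphEpi compose_def using assms
  by (intro arg_cong2[where f = Pair] restrict_ext) (auto simp: verts_graph)

lemma sys_inverse_system [simp]: "sys a \<in> inverse_systems mGraphEpi"
  using Gamma_sys_Obj[OF enum, of E a] by (simp add: Pro_def)

section \<open>From isomorphisms of inverse systems to branch maps\<close>

lemma label_ends_in: "l \<in> labels \<Longrightarrow> label_src l \<in> D" "l \<in> labels \<Longrightarrow> label_tgt l \<in> D"
  by (auto simp: labels_def)

lemma label_eqI: "l \<in> labels \<Longrightarrow> label_src l \<noteq> label_tgt l \<Longrightarrow> l = Arc (label_src l) (label_tgt l) \<and> (label_src l, label_tgt l) \<in> E"
  by (auto simp: labels_def)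

text \<open>The stage maps cohere along each branch and define \<open>h\<close> in the limit, with
  modulus \<open>\<phi>\<close>. Bonding maps fix labels, so all stages induce the same map on
  labels, and incidence determines \<open>h\<close> on the branches \<open>z d\<close>. At this
  point \<open>\<pi>\<close> may still identify vertices, hence the proviso
  \<open>\<pi> d \<noteq> \<pi> e\<close>.\<close>

lemma premorphism_branch_map:
  assumes p: "(\<phi>, f) \<in> premorphisms mGraphEpi (sys a) (sys a')"
  obtains h \<pi> where "unif_map (brs a) (brs a') h"
    and "\<And>n x. n \<ge> 1 \<Longrightarrow> x \<in> brs a \<Longrightarrow> fst (f n) (restr x (\<phi> n)) = restr (h x) n"
    and "\<pi> \<in> D \<rightarrow> D" "\<And>d. d \<in> D \<Longrightarrow> h (z d) = z (\<pi> d)"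
    and "\<And>d e. d \<in> D \<Longrightarrow> e \<in> D \<Longrightarrow> (d, e) \<in> E \<Longrightarrow> \<pi> d \<noteq> \<pi> e \<Longrightarrow> (\<pi> d, \<pi> e) \<in> E"
proof -
  note p' = mGraph.premorphismD[OF p, unfolded stage_sys]
  have vert: "fst (f n) (restr x (\<phi> n)) \<in> verts (graph a' n)" if "n \<ge> 1" "x \<in> brs a" for n x
    using p'(3)[OF that(1)] that(2) by (auto simp: Hom_mGraphEpi_iff verts_graph)
  have lab: "snd (f n) l \<in> labels" if "n \<ge> 1" "l \<in> labels" for n l
    using p'(3)[OF that(1)] that(2) by (auto simp: Hom_mGraphEpi_iff)
  have vert_take: "take n (fst (f m) (restr x (\<phi> m))) = fst (f n) (restr x (\<phi> n))"
    if n: "n \<ge> 1" "m \<ge> n" and x: "x \<in> brs a" for m n x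
  proof -
    have "m \<ge> 1" using n by simp
    obtain y where y: "y \<in> brs a'" "fst (f m) (restr x (\<phi> m)) = restr y m"
      using vert[OF \<open>m \<ge> 1\<close> x] unfolding verts_graph by blast
    have "fst (bond (sys a') m n) (fst (f m) (restr x (\<phi> m))) =
        fst (f n) (fst (bond (sys a) (\<phi> m) (\<phi> n)) (restr x (\<phi> m)))"
      using arg_cong[OF p'(4)[OF n], of "\<lambda>q. fst q (restr x (\<phi> m))"] x by (simp add: Comp_graph)
    then show ?thesis
      using x y n p'(2)[OF n] by (simp add: bond_sys take_restr)
  qed
  have lab_const: "snd (f n) l = snd (f 1) l" if n: "n \<ge> 1" and l: "l \<in> labels" for n l
  proof -
    have "snd (bond (sys a') n 1) (snd (f n) l) = snd (f 1) (snd (bond (sys a) (\<phi> n) (\<phi> 1)) l)"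
      using arg_cong[OF p'(4)[OF le_refl n], of "\<lambda>q. snd q l"] l by (simp add: Comp_graph)
    then show ?thesis
      using l lab[OF n l] by (simp add: bond_sys)
  qed
  \<comment> \<open>Coordinate \<open>i\<close> is read at stage \<open>Suc i\<close>, the first one
    whose nodes are long enough; later stages give the same value by compatibility.\<close>
  define h where "h = (\<lambda>x i. fst (f (Suc i)) (restr x (\<phi> (Suc i))) ! i)"
  have h: "fst (f n) (restr x (\<phi> n)) = restr (h x) n" if n: "n \<ge> 1" and x: "x \<in> brs a" for n x
  proof (rule nth_equalityI)
    have len: "length (fst (f n) (restr x (\<phi> n))) = n"
      using vert[OF n x] by (auto simp: verts_graph)
    then show "length (fst (f n) (restr x (\<phi> n))) = length (restr (h x) n)"
      by simp
    fix i assume "i < length (fst (f n) (restr x (\<phi> n)))"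
    then have i: "i < n" using len by simp
    then have "h x i = take (Suc i) (fst (f n) (restr x (\<phi> n))) ! i"
      using vert_take[of "Suc i" n x] x by (simp add: h_def)
    then show "fst (f n) (restr x (\<phi> n)) ! i = restr (h x) n ! i"
      using i by (simp add: restr_def)
  qed
  have h_in: "h x \<in> brs a'" if x: "x \<in> brs a" for x
  proof -
    have "restr (h x) n \<in> wtree D enum a'" for n
    proof (cases n)
      case 0
      then show ?thesis by (simp add: restr_def wtree_def)
    next
      case (Suc m)
      then show ?thesis
        using vert[of n x] h[of n x] x by (simp add: Gamma_graph_def)
    qed
    then show ?thesis by (simp add: branches_def)
  qed
  have "\<exists>m. \<forall>x\<in>brs a. \<forall>y\<in>brs a. restr x m = restr y m \<longrightarrow> restr (h x) n = restr (h y) n" for n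
  proof (cases "n \<ge> 1")
    case True
    then have "restr (h x) n = restr (h y) n"
      if "x \<in> brs a" "y \<in> brs a" "restr x (\<phi> n) = restr y (\<phi> n)" for x y
      using h[OF True that(1)] h[OF True that(2)] that(3) by metis
    then show ?thesis by blast
  qed (simp add: restr_eq_iff)
  then have unif: "unif_map (brs a) (brs a') h"
    using h_in unfolding unif_map_def by blast
  define w where "w = snd (f 1)"
  have ends: "h (z (label_src l)) = z (label_src (w l))" "h (z (label_tgt l)) = z (label_tgt (w l))"
    if l: "l \<in> labels" for l
  proof -
    have *: "restr (h (z (label_src l))) n = restr (z (label_src (w l))) n"
      "restr (h (z (label_tgt l))) n = restr (z (label_tgt (w l))) n" if n: "n \<ge> 1" for n
    proof -
      have "tail (graph a' n) (w l) = fst (f n) (tail (graph a (\<phi> n)) l)"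
        "head (graph a' n) (w l) = fst (f n) (head (graph a (\<phi> n)) l)"
        using p'(3)[OF n] l unfolding Hom_mGraphEpi_iff w_def lab_const[OF n l, symmetric] by simp_all
      then show "restr (h (z (label_src l))) n = restr (z (label_src (w l))) n"
        "restr (h (z (label_tgt l))) n = restr (z (label_tgt (w l))) n"
        using h[OF n z_in_brs] by simp_all
    qed
    show "h (z (label_src l)) = z (label_src (w l))" "h (z (label_tgt l)) = z (label_tgt (w l))"
      by (rule seq_eqI, erule *)+
  qed
  \<comment> \<open>The loop makes every distinguished vertex an endpoint of an edge, even if
    \<open>d\<close> is isolated in \<open>E\<close>, and so forces \<open>h\<close> to send
    \<open>z d\<close> to a distinguished branch.\<close>
  define \<pi> where "\<pi> = (\<lambda>d. label_src (w (Loop d)))"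
  have w: "w l \<in> labels" if "l \<in> labels" for l
    using lab that by (simp add: w_def)
  have loop: "Loop d \<in> labels" if "d \<in> D" for d
    using that by (simp add: labels_def)
  have \<pi>: "\<pi> d \<in> D" "h (z d) = z (\<pi> d)" if "d \<in> D" for d
    using label_ends_in(1)[OF w[OF loop[OF that]]] ends(1)[OF loop[OF that]] by (simp_all add: \<pi>_def)
  have "(\<pi> d, \<pi> e) \<in> E" if "d \<in> D" "e \<in> D" "(d, e) \<in> E" "\<pi> d \<noteq> \<pi> e" for d e
  proof -
    have "d \<noteq> e" using that irrefl by (auto simp: irrefl_on_def)
    then have l: "Arc d e \<in> labels" using that by (simp add: labels_def)
    have "\<pi> d = label_src (w (Arc d e))" "\<pi> e = label_tgt (w (Arc d e))"
      using ends[OF l] \<pi>[OF that(1)] \<pi>[OF that(2)] z_inject label_ends_in[OF w[OF l]]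
      by (simp_all only: label_src.simps label_tgt.simps)
    \<comment> \<open>Distinct ends rule out a loop, so the image edge is a copy of a pair in
      \<open>E\<close>.\<close>
    then show ?thesis
      using label_eqI[OF w[OF l]] that(4) by simp
  qed
  then show ?thesis
    using that unif h \<pi> by blast
qed

text \<open>The equivalence with the identity is evaluated on the node of \<open>x\<close> at the
  witnessing stage \<open>r\<close>: one side gives the first \<open>n\<close> coordinates of
  \<open>k (h x)\<close>, the other those of \<open>x\<close>.\<close>

lemma premorphism_comp_ident:
  assumes q: "(\<psi>, g) \<in> premorphisms mGraphEpi (sys a') (sys a)"
    and rel: "(premor_comp mGraphEpi (sys a) (sys a') (sys a) (\<psi>, g) (\<phi>, f), premor_ident mGraphEpi (sys a))
      \<in> premor_rel mGraphEpi (sys a) (sys a)"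
    and h: "\<And>n x. n \<ge> 1 \<Longrightarrow> x \<in> brs a \<Longrightarrow> fst (f n) (restr x (\<phi> n)) = restr (h x) n" "h \<in> brs a \<rightarrow> brs a'"
    and k: "\<And>n x. n \<ge> 1 \<Longrightarrow> x \<in> brs a' \<Longrightarrow> fst (g n) (restr x (\<psi> n)) = restr (k x) n"
    and x: "x \<in> brs a"
  shows "k (h x) = x"
proof (rule seq_eqI)
  fix n :: nat assume n: "n \<ge> 1"
  have \<psi>: "\<psi> n \<ge> 1" using mGraph.premorphismD(1)[OF q n] .
  let ?c = "Comp mGraphEpi (graph a (\<phi> (\<psi> n))) (graph a' (\<psi> n)) (graph a n) (g n) (f (\<psi> n))"
  obtain r where r: "r \<ge> \<phi> (\<psi> n)" "r \<ge> n" and eq: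
    "Comp mGraphEpi (graph a r) (graph a (\<phi> (\<psi> n))) (graph a n) ?c (bond (sys a) r (\<phi> (\<psi> n))) =
     Comp mGraphEpi (graph a r) (graph a n) (graph a n) (Ident mGraphEpi (graph a n)) (bond (sys a) r n)"
    using mGraph.premor_relD(3)[OF rel[unfolded premor_comp.simps premor_ident_def] n] by auto
  have "fst ?c (restr x (\<phi> (\<psi> n))) = restr x n"
    using arg_cong[OF eq, of "\<lambda>p. fst p (restr x r)"] x r by (simp add: Comp_graph bond_sys Ident_graph)
  moreover have "fst ?c (restr x (\<phi> (\<psi> n))) = restr (k (h x)) n"
    using x h(1)[OF \<psi> x] h(2) k[OF n] by (auto simp: Comp_graph)
  ultimately show "restr (k (h x)) n = restr x n"
    by simp
qed

text \<open>Since \<open>h\<close> and \<open>k\<close> are mutually inverse and \<open>z\<close> is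
  injective on \<open>D\<close>, so are \<open>\<pi>\<close> and \<open>\<rho>\<close>. Hence
  neither identifies vertices, and edges are preserved in both directions.\<close>

lemma isomorphic_imp_unif:
  assumes "isomorphic_in (Pro mGraphEpi) (sys a) (sys a')"
  obtains \<pi> h k where "\<pi> \<in> digraph_Aut D E" "unif_map (brs a) (brs a') h" "unif_map (brs a') (brs a) k"
    "\<And>x. x \<in> brs a \<Longrightarrow> k (h x) = x" "\<And>y. y \<in> brs a' \<Longrightarrow> h (k y) = y"
    "\<And>d. d \<in> D \<Longrightarrow> h (z d) = z (\<pi> d)"
proof -
  obtain \<phi> f \<psi> g where p: "(\<phi>, f) \<in> premorphisms mGraphEpi (sys a) (sys a')"
    and q: "(\<psi>, g) \<in> premorphisms mGraphEpi (sys a') (sys a)"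
    and rel: "(premor_comp mGraphEpi (sys a) (sys a') (sys a) (\<psi>, g) (\<phi>, f), premor_ident mGraphEpi (sys a))
      \<in> premor_rel mGraphEpi (sys a) (sys a)"
    and rel': "(premor_comp mGraphEpi (sys a') (sys a) (sys a') (\<phi>, f) (\<psi>, g), premor_ident mGraphEpi (sys a'))
      \<in> premor_rel mGraphEpi (sys a') (sys a')"
    using assms unfolding mGraph.isomorphic_in_Pro_iff[OF sys_inverse_system sys_inverse_system] by fast
  obtain h \<pi> where h: "unif_map (brs a) (brs a') h"
    "\<And>n x. n \<ge> 1 \<Longrightarrow> x \<in> brs a \<Longrightarrow> fst (f n) (restr x (\<phi> n)) = restr (h x) n"
    and \<pi>: "\<pi> \<in> D \<rightarrow> D" "\<And>d. d \<in> D \<Longrightarrow> h (z d) = z (\<pi> d)"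
    "\<And>d e. d \<in> D \<Longrightarrow> e \<in> D \<Longrightarrow> (d, e) \<in> E \<Longrightarrow> \<pi> d \<noteq> \<pi> e \<Longrightarrow> (\<pi> d, \<pi> e) \<in> E"
    using premorphism_branch_map[OF p] by blast
  obtain k \<rho> where k: "unif_map (brs a') (brs a) k"
    "\<And>n x. n \<ge> 1 \<Longrightarrow> x \<in> brs a' \<Longrightarrow> fst (g n) (restr x (\<psi> n)) = restr (k x) n"
    and \<rho>: "\<rho> \<in> D \<rightarrow> D" "\<And>d. d \<in> D \<Longrightarrow> k (z d) = z (\<rho> d)"
    "\<And>d e. d \<in> D \<Longrightarrow> e \<in> D \<Longrightarrow> (d, e) \<in> E \<Longrightarrow> \<rho> d \<noteq> \<rho> e \<Longrightarrow> (\<rho> d, \<rho> e) \<in> E"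
    using premorphism_branch_map[OF q] by blast
  have hm: "h \<in> brs a \<rightarrow> brs a'" "k \<in> brs a' \<rightarrow> brs a"
    using h(1) k(1) unfolding unif_map_def by blast+
  have kh: "k (h x) = x" if "x \<in> brs a" for x
    using premorphism_comp_ident[OF q rel h(2) hm(1) k(2) that] .
  have hk: "h (k y) = y" if "y \<in> brs a'" for y
    using premorphism_comp_ident[OF p rel' k(2) hm(2) h(2) that] .
  have \<pi>D: "\<pi> d \<in> D" "\<rho> d \<in> D" if "d \<in> D" for d
    using \<pi>(1) \<rho>(1) that by blast+
  have \<rho>\<pi>: "\<rho> (\<pi> d) = d" if "d \<in> D" for d
    using kh[OF z_in_brs, of d] \<pi>(2)[OF that] \<rho>(2)[OF \<pi>D(1)[OF that]] z_inject \<pi>D that by simp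
  have \<pi>\<rho>: "\<pi> (\<rho> d) = d" if "d \<in> D" for d
    using hk[OF z_in_brs, of d] \<rho>(2)[OF that] \<pi>(2)[OF \<pi>D(2)[OF that]] z_inject \<pi>D that by simp
  have ne: "d \<noteq> e" if "d \<in> D" "(d, e) \<in> E" for d e
    using that irrefl by (auto simp: irrefl_on_def)
  have "bij_betw \<pi> D D"
    using \<pi>D \<rho>\<pi> \<pi>\<rho> by (intro bij_betw_byWitness[of _ \<rho>]) blast+
  moreover have "(\<pi> d, \<pi> e) \<in> E" if "d \<in> D" "e \<in> D" "(d, e) \<in> E" for d e
    using \<pi>(3)[OF that] ne[OF that(1,3)] \<rho>\<pi> that by metis
  moreover have "(d, e) \<in> E" if "d \<in> D" "e \<in> D" "(\<pi> d, \<pi> e) \<in> E" for d e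
    using \<rho>(3)[OF \<pi>D(1)[OF that(1)] \<pi>D(1)[OF that(2)] that(3)] ne[OF \<pi>D(1)[OF that(1)] that(3)] \<rho>\<pi> that
    by metis
  ultimately have "\<pi> \<in> digraph_Aut D E"
    unfolding digraph_Aut_def by blast
  then show ?thesis
    using that h(1) k(1) kh hk \<pi>(2) by blast
qed

section \<open>From level-shifting maps to isomorphisms of inverse systems\<close>

definition shift_premor ::
  "nat \<Rightarrow> ('d \<Rightarrow> nat) \<Rightarrow> ((nat \<Rightarrow> nat) \<Rightarrow> nat \<Rightarrow> nat) \<Rightarrow> ('d \<Rightarrow> 'd)
     \<Rightarrow> ((nat list \<Rightarrow> nat list) \<times> ('d label \<Rightarrow> 'd label)) premor" where
  "shift_premor M a h \<pi> = (\<lambda>n. n + M, \<lambda>n.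
     (\<lambda>s\<in>verts (graph a (n + M)). restr (h (SOME x. x \<in> brs a \<and> restr x (n + M) = s)) n,
      \<lambda>l\<in>labels. map_label \<pi> l))"

text \<open>A node of level \<open>n + M\<close> is sent to the image of an arbitrarily chosen
  branch through it, cut off at \<open>n\<close>; the modulus of \<open>h\<close> makes the result
  independent of the choice.\<close>

lemma shift_premor_apply:
  assumes "shift_map M (brs a) (brs a') h"
  shows "x \<in> brs a \<Longrightarrow> fst (snd (shift_premor M a h \<pi>) n) (restr x (n + M)) = restr (h x) n"
    and "l \<in> labels \<Longrightarrow> snd (snd (shift_premor M a h \<pi>) n) l = map_label \<pi> l"
proof -
  assume x: "x \<in> brs a"
  let ?y = "SOME y. y \<in> brs a \<and> restr y (n + M) = restr x (n + M)"
  have "?y \<in> brs a \<and> restr ?y (n + M) = restr x (n + M)"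
    by (rule someI[of "\<lambda>y. y \<in> brs a \<and> restr y (n + M) = restr x (n + M)" x]) (simp add: x)
  then have "restr (h ?y) n = restr (h x) n"
    using shift_mapD(2)[OF assms, of ?y x n] x by blast
  then show "fst (snd (shift_premor M a h \<pi>) n) (restr x (n + M)) = restr (h x) n"
    using x by (simp add: shift_premor_def verts_graph)
qed (simp add: shift_premor_def)

text \<open>Surjectivity is where it matters that an automorphism also reflects edges.\<close>

lemma map_label_labels:
  assumes "\<pi> \<in> digraph_Aut D E"
  shows "map_label \<pi> ` labels = labels"
proof -
  have \<pi>: "bij_betw \<pi> D D" "\<And>d e. d \<in> D \<Longrightarrow> e \<in> D \<Longrightarrow> (d, e) \<in> E \<longleftrightarrow> (\<pi> d, \<pi> e) \<in> E"
    using assms unfolding digraph_Aut_def by blast+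
  have sub: "map_label \<pi> l \<in> labels" if "l \<in> labels" for l
  proof -
    have D: "\<pi> d \<in> D" if "d \<in> D" for d
      using bij_betwE[OF \<pi>(1)] that by blast
    have ne: "\<pi> d \<noteq> \<pi> e" if "d \<in> D" "e \<in> D" "d \<noteq> e" for d e
      using bij_betw_imp_inj_on[OF \<pi>(1)] that by (simp add: inj_on_eq_iff)
    show ?thesis
      using that by (cases l) (simp_all add: labels_def D ne \<pi>(2)[symmetric])
  qed
  have "l \<in> map_label \<pi> ` labels" if l: "l \<in> labels" for l
  proof -
    have D: "\<exists>c\<in>D. d = \<pi> c" if "d \<in> D" for d
      using bij_betw_imp_surj_on[OF \<pi>(1)] that by blast
    consider d where "l = Loop d" "d \<in> D" | d e where "l = Arc d e" "d \<in> D" "e \<in> D" "d \<noteq> e" "(d, e) \<in> E"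
      using l by (auto simp: labels_def)
    then show ?thesis
    proof cases
      case 1
      then obtain c where "c \<in> D" "d = \<pi> c" using D by blast
      then show ?thesis using 1 by (intro image_eqI[of _ _ "Loop c"]) (simp_all add: labels_def)
    next
      case 2
      then obtain c b where "c \<in> D" "d = \<pi> c" "b \<in> D" "e = \<pi> b" using D by meson
      then show ?thesis using 2 \<pi>(2)
        by (intro image_eqI[of _ _ "Arc c b"]) (auto simp: labels_def)
    qed
  qed
  then show ?thesis using sub by blast
qed

text \<open>Surjectivity on vertices comes from that of \<open>h\<close>, on edges from
  \<open>\<pi>\<close>; incidence is the condition \<open>h (z d) = z (\<pi> d)\<close>. In the
  compatibility squares both ways round give the first \<open>n\<close> coordinates of
  \<open>h x\<close>.\<close>

lemma shift_premor_premorphism: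
  assumes h: "shift_map M (brs a) (brs a') h" "h ` brs a = brs a'"
    and \<pi>: "\<pi> \<in> digraph_Aut D E" and hz: "\<And>d. d \<in> D \<Longrightarrow> h (z d) = z (\<pi> d)"
  shows "shift_premor M a h \<pi> \<in> premorphisms mGraphEpi (sys a) (sys a')"
proof -
  let ?f = "snd (shift_premor M a h \<pi>)"
  note app = shift_premor_apply[OF h(1)]
  have lab: "map_label \<pi> l \<in> labels" if "l \<in> labels" for l
    using map_label_labels[OF \<pi>] that by blast
  have hom: "?f n \<in> Hom mGraphEpi (graph a (n + M)) (graph a' n)" for n
    unfolding Hom_mGraphEpi_iff
  proof (intro conjI)
    have *: "fst (?f n) ` verts (graph a (n + M)) = (\<lambda>x. restr (h x) n) ` brs a"
      unfolding verts_graph image_image by (rule image_cong) (simp_all add: app)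
    also have "\<dots> = verts (graph a' n)"
      unfolding verts_graph h(2)[symmetric] image_image ..
    finally show im: "fst (?f n) ` verts (graph a (n + M)) = verts (graph a' n)" .
    have "fst (?f n) \<in> extensional (verts (graph a (n + M)))"
      by (simp add: shift_premor_def)
    then show "fst (?f n) \<in> verts (graph a (n + M)) \<rightarrow>\<^sub>E verts (graph a' n)"
      using im by (auto simp: PiE_def)
    show im': "snd (?f n) ` arcs (graph a (n + M)) = arcs (graph a' n)"
      using map_label_labels[OF \<pi>] app(2) by simp
    have "snd (?f n) \<in> extensional (arcs (graph a (n + M)))"
      by (simp add: shift_premor_def)
    then show "snd (?f n) \<in> arcs (graph a (n + M)) \<rightarrow>\<^sub>E arcs (graph a' n)"
      using im' by (auto simp: PiE_def)
    show "\<forall>e\<in>arcs (graph a (n + M)).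
      tail (graph a' n) (snd (?f n) e) = fst (?f n) (tail (graph a (n + M)) e) \<and>
      head (graph a' n) (snd (?f n) e) = fst (?f n) (head (graph a (n + M)) e)"
    proof
      fix l assume l: "l \<in> arcs (graph a (n + M))"
      then have "label_src (map_label \<pi> l) = \<pi> (label_src l)" "label_tgt (map_label \<pi> l) = \<pi> (label_tgt l)"
        by (cases l; simp)+
      then show "tail (graph a' n) (snd (?f n) l) = fst (?f n) (tail (graph a (n + M)) l) \<and>
        head (graph a' n) (snd (?f n) l) = fst (?f n) (head (graph a (n + M)) l)"
        using l hz label_ends_in[of l] by (simp add: app)
    qed
  qed
  have comp: "Comp mGraphEpi (graph a (m + M)) (graph a' m) (graph a' n) (bond (sys a') m n) (?f m) =
      Comp mGraphEpi (graph a (m + M)) (graph a (n + M)) (graph a' n) (?f n) (bond (sys a) (m + M) (n + M))"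
    if "n \<le> m" for m n
  proof (rule Comp_graph_eqI)
    fix x assume x: "x \<in> brs a"
    then have "h x \<in> brs a'" using h(2) by blast
    then show "fst (bond (sys a') m n) (fst (?f m) (restr x (m + M))) =
        fst (?f n) (fst (bond (sys a) (m + M) (n + M)) (restr x (m + M)))"
      using x that by (simp add: app bond_sys)
  qed (simp add: app bond_sys lab)
  have pair: "shift_premor M a h \<pi> = (\<lambda>n. n + M, ?f)"
    by (simp add: shift_premor_def)
  have mono: "strict_mono_on {1..} (\<lambda>n. n + M)" "(\<lambda>n. n + M) \<in> {1..} \<rightarrow> {1::nat..}"
    by (auto simp: strict_mono_on_def)
  show ?thesis
    by (subst pair, unfold premorphisms_def mem_Collect_eq prod.case stage_sys)
      (intro conjI allI impI mono hom comp)
qed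

text \<open>The composite has index \<open>n + M + M\<close> and acts there as truncation to level
  \<open>n\<close>, so this index itself witnesses the equivalence with the identity.\<close>

lemma shift_premor_comp_ident:
  assumes h: "shift_map M (brs a) (brs a') h" "h ` brs a = brs a'"
    and \<pi>: "\<pi> \<in> digraph_Aut D E" and hz: "\<And>d. d \<in> D \<Longrightarrow> h (z d) = z (\<pi> d)"
    and k: "shift_map M (brs a') (brs a) k" "k ` brs a' = brs a"
    and \<rho>: "\<rho> \<in> digraph_Aut D E" and kz: "\<And>d. d \<in> D \<Longrightarrow> k (z d) = z (\<rho> d)"
    and kh: "\<And>x. x \<in> brs a \<Longrightarrow> k (h x) = x" and \<rho>\<pi>: "\<And>d. d \<in> D \<Longrightarrow> \<rho> (\<pi> d) = d"
  shows "(premor_comp mGraphEpi (sys a) (sys a') (sys a) (shift_premor M a' k \<rho>) (shift_premor M a h \<pi>),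
    premor_ident mGraphEpi (sys a)) \<in> premor_rel mGraphEpi (sys a) (sys a)"
proof -
  let ?f = "snd (shift_premor M a h \<pi>)" and ?g = "snd (shift_premor M a' k \<rho>)"
  note app = shift_premor_apply[OF h(1)] shift_premor_apply[OF k(1)]
  have pf: "shift_premor M a h \<pi> = (\<lambda>n. n + M, ?f)" and pg: "shift_premor M a' k \<rho> = (\<lambda>n. n + M, ?g)"
    by (simp_all add: shift_premor_def)
  let ?c = "\<lambda>n. Comp mGraphEpi (graph a (n + M + M)) (graph a' (n + M)) (graph a n) (?g n) (?f (n + M))"
  have c: "premor_comp mGraphEpi (sys a) (sys a') (sys a) (shift_premor M a' k \<rho>) (shift_premor M a h \<pi>) =
      (\<lambda>n. n + M + M, ?c)"
    by (subst pf, subst pg) (simp add: o_def)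
  have "(\<lambda>n. n + M + M, ?c) \<in> premorphisms mGraphEpi (sys a) (sys a)"
    unfolding c[symmetric] using mGraph.premor_comp_premorphism
      shift_premor_premorphism[where h = h and \<pi> = \<pi>, OF h \<pi> hz]
      shift_premor_premorphism[where h = k and \<pi> = \<rho>, OF k \<rho> kz] sys_inverse_system by blast
  moreover have "premor_ident mGraphEpi (sys a) \<in> premorphisms mGraphEpi (sys a) (sys a)"
    by (rule mGraph.premor_ident_premorphism[OF sys_inverse_system])
  moreover have "Comp mGraphEpi (graph a (n + M + M)) (graph a (n + M + M)) (graph a n) (?c n)
        (bond (sys a) (n + M + M) (n + M + M)) =
      Comp mGraphEpi (graph a (n + M + M)) (graph a n) (graph a n) (Ident mGraphEpi (graph a n))
        (bond (sys a) (n + M + M) n)" for n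
  proof (rule Comp_graph_eqI)
    fix x assume x: "x \<in> brs a"
    then have "h x \<in> brs a'" using h(2) by blast
    then show "fst (?c n) (fst (bond (sys a) (n + M + M) (n + M + M)) (restr x (n + M + M))) =
      fst (Ident mGraphEpi (graph a n)) (fst (bond (sys a) (n + M + M) n) (restr x (n + M + M)))"
      using x kh by (simp add: app bond_sys Comp_graph Ident_graph)
  next
    fix l assume l: "l \<in> labels"
    then have "map_label \<pi> l \<in> labels" using map_label_labels[OF \<pi>] by blast
    moreover have "map_label \<rho> (map_label \<pi> l) = l"
      using l \<rho>\<pi> label_ends_in[OF l] by (cases l) auto
    ultimately show "snd (?c n) (snd (bond (sys a) (n + M + M) (n + M + M)) l) =
      snd (Ident mGraphEpi (graph a n)) (snd (bond (sys a) (n + M + M) n) l)"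
      using l by (simp add: app bond_sys Comp_graph Ident_graph)
  qed
  ultimately show ?thesis
    unfolding c premor_ident_def stage_sys id_def
  proof (intro mGraph.premor_relI)
    fix n
    assume "\<And>n. Comp mGraphEpi (graph a (n + M + M)) (graph a (n + M + M)) (graph a n) (?c n)
        (bond (sys a) (n + M + M) (n + M + M)) =
      Comp mGraphEpi (graph a (n + M + M)) (graph a n) (graph a n) (Ident mGraphEpi (graph a n))
        (bond (sys a) (n + M + M) n)"
    then show "\<exists>r\<ge>n + M + M. n \<le> r \<and>
        Comp mGraphEpi (stage (sys a) r) (stage (sys a) (n + M + M)) (stage (sys a) n) (?c n) (bond (sys a) r (n + M + M)) =
        Comp mGraphEpi (stage (sys a) r) (stage (sys a) n) (stage (sys a) n) (Ident mGraphEpi (graph a n)) (bond (sys a) r n)"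
      unfolding stage_sys by (intro exI[of _ "n + M + M"]) simp
  qed
qed

lemma digraph_Aut_inv_into:
  assumes "\<pi> \<in> digraph_Aut D E"
  shows "inv_into D \<pi> \<in> digraph_Aut D E"
proof -
  have \<pi>: "bij_betw \<pi> D D" "\<And>d e. d \<in> D \<Longrightarrow> e \<in> D \<Longrightarrow> (d, e) \<in> E \<longleftrightarrow> (\<pi> d, \<pi> e) \<in> E"
    using assms unfolding digraph_Aut_def by blast+
  have "inv_into D \<pi> d \<in> D" "\<pi> (inv_into D \<pi> d) = d" if "d \<in> D" for d
    using \<pi>(1) that by (auto simp: bij_betw_def inv_into_into f_inv_into_f)
  then show ?thesis
    using \<pi>(2) bij_betw_inv_into[OF \<pi>(1)] unfolding digraph_Aut_def by fastforce
qed

lemma shift_equiv_imp_isomorphic: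
  assumes hk: "shift_equiv M (brs a) (brs a') h k"
    and \<pi>: "\<pi> \<in> digraph_Aut D E" and hz: "\<And>d. d \<in> D \<Longrightarrow> h (z d) = z (\<pi> d)"
  shows "isomorphic_in (Pro mGraphEpi) (sys a) (sys a')"
proof -
  define \<rho> where "\<rho> = inv_into D \<pi>"
  have \<rho>: "\<rho> \<in> digraph_Aut D E"
    unfolding \<rho>_def by (rule digraph_Aut_inv_into[OF \<pi>])
  have "bij_betw \<pi> D D" using \<pi> unfolding digraph_Aut_def by blast
  then have \<rho>\<pi>: "\<And>d. d \<in> D \<Longrightarrow> \<rho> (\<pi> d) = d" "\<And>d. d \<in> D \<Longrightarrow> \<pi> (\<rho> d) = d" "\<And>d. d \<in> D \<Longrightarrow> \<rho> d \<in> D"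
    by (auto simp: \<rho>_def bij_betw_def inv_into_into f_inv_into_f)
  note sh = shift_equivD[OF hk]
  have surj: "h ` brs a = brs a'" "k ` brs a' = brs a"
    using sh(3,4) shift_mapD(1)[OF sh(1)] shift_mapD(1)[OF sh(2)] by force+
  have kz: "k (z d) = z (\<rho> d)" if "d \<in> D" for d
    using sh(3)[OF z_in_brs, of "\<rho> d"] hz[OF \<rho>\<pi>(3)[OF that]] \<rho>\<pi>(2)[OF that] by simp
  have "(premor_comp mGraphEpi (sys a) (sys a') (sys a) (shift_premor M a' k \<rho>) (shift_premor M a h \<pi>),
      premor_ident mGraphEpi (sys a)) \<in> premor_rel mGraphEpi (sys a) (sys a)"
    by (rule shift_premor_comp_ident[where h = h and k = k and \<pi> = \<pi> and \<rho> = \<rho>, OF sh(1) surj(1) \<pi> hz sh(2) surj(2) \<rho> kz sh(3) \<rho>\<pi>(1)])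
  moreover have "(premor_comp mGraphEpi (sys a') (sys a) (sys a') (shift_premor M a h \<pi>) (shift_premor M a' k \<rho>),
      premor_ident mGraphEpi (sys a')) \<in> premor_rel mGraphEpi (sys a') (sys a')"
    by (rule shift_premor_comp_ident[where h = k and k = h and \<pi> = \<rho> and \<rho> = \<pi>, OF sh(2) surj(2) \<rho> kz sh(1) surj(1) \<pi> hz sh(4) \<rho>\<pi>(2)])
  moreover have "shift_premor M a h \<pi> \<in> premorphisms mGraphEpi (sys a) (sys a')"
    by (rule shift_premor_premorphism[where h = h and \<pi> = \<pi>, OF sh(1) surj(1) \<pi> hz])
  moreover have "shift_premor M a' k \<rho> \<in> premorphisms mGraphEpi (sys a') (sys a)"
    by (rule shift_premor_premorphism[where h = k and \<pi> = \<rho>, OF sh(2) surj(2) \<rho> kz])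
  ultimately show ?thesis
    unfolding mGraph.isomorphic_in_Pro_iff[OF sys_inverse_system sys_inverse_system] by blast
qed

end

section \<open>The equivalence of the four conditions\<close>

theorem theorem3p3:
  fixes D :: "'d set" and E :: "'d rel" and enum :: "nat \<Rightarrow> 'd" and a a' :: "'d \<Rightarrow> nat"
  assumes enum: "bij_betw enum UNIV D"
    and E_sub: "E \<subseteq> D \<times> D"
    and E_irrefl: "irrefl_on D E"
  shows
    "((\<exists>\<pi>\<in>digraph_Aut D E. \<exists>M::nat. \<forall>d\<in>D. \<bar>int (a d) - int (a' (\<pi> d))\<bar> \<le> int M)
        \<longleftrightarrow> isomorphic_in (Pro mGraphEpi) (Gamma_sys D E enum a) (Gamma_sys D E enum a')) \<and>
     ((\<exists>\<pi>\<in>digraph_Aut D E. \<exists>M::nat. \<forall>d\<in>D. \<bar>int (a d) - int (a' (\<pi> d))\<bar> \<le> int M)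
        \<longleftrightarrow> (\<exists>\<pi>\<in>digraph_Aut D E. \<exists>h.
              uniform_homeomorphism (branch_space (wtree D enum a)) (branch_space (wtree D enum a')) h \<and>
              (\<forall>d\<in>D. h (zbr enum d) = zbr enum (\<pi> d)))) \<and>
     ((\<exists>\<pi>\<in>digraph_Aut D E. \<exists>M::nat. \<forall>d\<in>D. \<bar>int (a d) - int (a' (\<pi> d))\<bar> \<le> int M)
        \<longleftrightarrow> (\<exists>\<pi>\<in>digraph_Aut D E. \<exists>h.
              bi_Lipschitz_homeo (branch_space (wtree D enum a)) (branch_space (wtree D enum a')) h \<and>
              (\<forall>d\<in>D. h (zbr enum d) = zbr enum (\<pi> d)))) \<and>
     (\<forall>\<pi>\<in>digraph_Aut D E. \<forall>M::nat. (\<forall>d\<in>D. \<bar>int (a d) - int (a' (\<pi> d))\<bar> \<le> int M) \<longrightarrow>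
        (\<exists>h. bi_Lipschitz_homeo_with (2 ^ M) (branch_space (wtree D enum a)) (branch_space (wtree D enum a')) h \<and>
             (\<forall>d\<in>D. h (zbr enum d) = zbr enum (\<pi> d))))"
    (is "(?one \<longleftrightarrow> ?two) \<and> (?one \<longleftrightarrow> ?three) \<and> (?one \<longleftrightarrow> ?four) \<and> ?five")
proof -
  interpret weighted_trees D enum E
    using enum E_irrefl by unfold_locales
  have bij: "bij_betw \<pi> D D" if "\<pi> \<in> digraph_Aut D E" for \<pi>
    using that unfolding digraph_Aut_def by blast
  \<comment> \<open>The quantitative claim comes first, because it also supplies the bi-Lipschitz
    map of the fourth condition.\<close>
  have five: ?five
  proof (intro ballI allI impI)
    fix \<pi> and M :: nat
    assume \<pi>: "\<pi> \<in> digraph_Aut D E" and M: "\<forall>d\<in>D. \<bar>int (a d) - int (a' (\<pi> d))\<bar> \<le> int M"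
    obtain h k where "shift_equiv M (brs a) (brs a') h k" "\<And>d. d \<in> D \<Longrightarrow> h (z d) = z (\<pi> d)"
      using weighted_trees_shift_equiv[OF bij[OF \<pi>], of a a' M] M by blast
    then show "\<exists>h. bi_Lipschitz_homeo_with (2 ^ M) (branch_space (wtree D enum a)) (branch_space (wtree D enum a')) h \<and>
        (\<forall>d\<in>D. h (z d) = z (\<pi> d))"
      using shift_equiv_bi_Lipschitz by blast
  qed
  have one_two: ?two if one: ?one
  proof -
    obtain \<pi> M where \<pi>: "\<pi> \<in> digraph_Aut D E" and M: "\<forall>d\<in>D. \<bar>int (a d) - int (a' (\<pi> d))\<bar> \<le> int M"
      using one by blast
    obtain h k where "shift_equiv M (brs a) (brs a') h k" "\<And>d. d \<in> D \<Longrightarrow> h (z d) = z (\<pi> d)"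
      using weighted_trees_shift_equiv[OF bij[OF \<pi>], of a a' M] M by blast
    then show ?two
      using shift_equiv_imp_isomorphic \<pi> by blast
  qed
  have two_one: ?one if ?two
    using that
  proof (rule isomorphic_imp_unif)
    fix \<pi> h k
    assume \<pi>: "\<pi> \<in> digraph_Aut D E" and hk: "unif_map (brs a) (brs a') h" "unif_map (brs a') (brs a) k"
      "\<And>x. x \<in> brs a \<Longrightarrow> k (h x) = x" "\<And>y. y \<in> brs a' \<Longrightarrow> h (k y) = y"
      and hz: "\<And>d. d \<in> D \<Longrightarrow> h (z d) = z (\<pi> d)"
    show ?one
      using weight_difference_bound[OF hk bij[OF \<pi>] hz] \<pi> by blast
  qed
  \<comment> \<open>The metric conditions form a cycle: weights give a bi-Lipschitz map, which is a
    uniform homeomorphism, which bounds the weights.\<close>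
  have one_four: ?four if ?one
    using that five unfolding bi_Lipschitz_homeo_def by blast
  have four_three: ?three if ?four
    using that bi_Lipschitz_imp_uniform_homeomorphism by blast
  have three_one: ?one if three: ?three
  proof -
    obtain \<pi> h where \<pi>: "\<pi> \<in> digraph_Aut D E" and hz: "\<And>d. d \<in> D \<Longrightarrow> h (z d) = z (\<pi> d)"
      and h: "uniform_homeomorphism (branch_space (wtree D enum a)) (branch_space (wtree D enum a')) h"
      using three by blast
    let ?k = "inv_into (brs a) h"
    have b: "bij_betw h (brs a) (brs a')" and u: "unif_map (brs a) (brs a') h" "unif_map (brs a') (brs a) ?k"
      using h unfolding uniform_homeomorphism_def unif_map_iff_uniformly_continuous by simp_all
    show ?one
      using weight_difference_bound[OF u bij_betw_inv_into_left[OF b] bij_betw_inv_into_right[OF b] bij[OF \<pi>] hz] \<pi>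
      by blast
  qed
  show ?thesis
    using five one_two two_one one_four four_three three_one by blast
qed

end
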